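(* Let $n\ge 1$, let $\Omega\subset\mathbb{R}^n$ be a bounded open set with $C^{1,\gamma}$-boundary (for some $\gamma\in(0,1)$), and let $E\subseteq\mathbb{R}^n$ be a measurable set. Suppose that $\mathrm{Per}_{s_0}(E;\Omega)<\infty$ for some $s_0\in(0,1)$, and that the limit $$\alpha(E):=\lim_{s\searrow 0}\, s\int_{E\cap(\mathbb{R}^n\setminus B_1)}\frac{1}{|y|^{n+s}}\,dy$$ exists. Then the limit $\mu(E):=\lim_{s\searrow0} s\,\mathrm{Per}_s(E;\Omega)$ exists (that is, $E\in\mathcal{E}$) and $$\mu(E)=\big(1-\widetilde\alpha(E)\big)\,\mathcal{M}(E\cap\Omega)+\widetilde\alpha(E)\,\mathcal{M}(\Omega\setminus E),\qquad\text{where}\quad \widetilde\alpha(E):=\frac{\alpha(E)}{\mathcal{H}^{n-1}(S^{n-1})}.$$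
   Context: For $s\in(0,1)$ and measurable $A,B\subseteq\mathbb{R}^n$, set $L(A,B):=\int_A\int_B\frac{1}{|x-y|^{n+s}}\,dx\,dy\in[0,+\infty]$ (with $L(A,B)=0$ if $A$ or $B$ is empty). Write $\mathcal{C}E=\mathbb{R}^n\setminus E$. The $s$-perimeter of a measurable set $E\subseteq\mathbb{R}^n$ in $\Omega$ is $$\mathrm{Per}_s(E;\Omega):=L(E\cap\Omega,(\mathcal{C}E)\cap\Omega)+L(E\cap\Omega,(\mathcal{C}E)\cap(\mathcal{C}\Omega))+L(E\cap(\mathcal{C}\Omega),(\mathcal{C}E)\cap\Omega).$$ $\mathcal{E}$ denotes the family of sets $E\subseteq\mathbb{R}^n$ for which the limit $\mu(E):=\lim_{s\searrow0}s\,\mathrm{Per}_s(E;\Omega)$ exists (as a finite number). $B_1$ is the open unit ball centered at $0$. $\mathcal{H}^{n-1}(S^{n-1})$ is the $(n-1)$-dimensional Hausdorff measure of the unit sphere of $\mathbb{R}^n$, $|A|$ is the Lebesgue measure of $A$, and $\mathcal{M}(A):=\mathcal{H}^{n-1}(S^{n-1})\,|A|$. *)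

theory Defs
  imports "HOL-Analysis.Analysis"
begin

text \<open>Throughout, \<open>\<real>\<^sup>n\<close> is an arbitrary Euclidean space \<open>'a\<close> with \<open>n = DIM('a) \<ge> 1\<close>, and
  ``measurable'' means Lebesgue measurable.\<close>

section \<open>Hausdorff measure\<close>

text \<open>The factor \<open>unit_ball_vol d / 2 ^ d\<close> is the usual normalisation, making the \<open>d\<close>-dimensional
  Hausdorff measure agree with Lebesgue measure on \<open>\<real>\<^sup>d\<close>. Empty covering sets are singled out
  because \<open>0 ^ 0 = 1\<close>: they must cost nothing also for \<open>d = 0\<close> (counting measure).
  Boundedness is required because \<open>diameter\<close> is meaningful only on bounded sets.\<close>

definition hausdorff_cost :: "nat \<Rightarrow> 'a::euclidean_space set \<Rightarrow> ennreal" where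
  "hausdorff_cost d C =
     (if C = {} then 0 else ennreal (unit_ball_vol (real d) * (diameter C / 2) ^ d))"

definition hausdorff_pre_measure :: "nat \<Rightarrow> real \<Rightarrow> 'a::euclidean_space set \<Rightarrow> ennreal" where
  "hausdorff_pre_measure d \<delta> A =
     (INF C \<in> {C :: nat \<Rightarrow> 'a set. A \<subseteq> (\<Union>i. C i) \<and> (\<forall>i. bounded (C i) \<and> diameter (C i) \<le> \<delta>)}.
        (\<Sum>i. hausdorff_cost d (C i)))"

definition hausdorff_measure :: "nat \<Rightarrow> 'a::euclidean_space set \<Rightarrow> ennreal" where
  "hausdorff_measure d A = (SUP \<delta>\<in>{0<..}. hausdorff_pre_measure d \<delta> A)"

definition sphere_measure :: "'a::euclidean_space itself \<Rightarrow> real" where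
  "sphere_measure _ = enn2real (hausdorff_measure (DIM('a) - 1) (sphere (0::'a) 1))"

text \<open>Only used for sets of finite Lebesgue measure.\<close>

definition scaled_volume :: "'a::euclidean_space set \<Rightarrow> real" where
  "scaled_volume A = sphere_measure TYPE('a) * measure lebesgue A"

section \<open>Domains with \<open>C\<^sup>1\<^sup>,\<^sup>\<gamma>\<close> boundary\<close>

text \<open>Near every boundary point \<open>p\<close>, and up to a rotation, the set is the subgraph of a
  \<open>C\<^sup>1\<^sup>,\<^sup>\<gamma>\<close> function \<open>\<phi>\<close> of \<open>n - 1\<close> variables. The vector \<open>e\<close> is the vertical direction,
  \<open>H\<close> the hyperplane orthogonal to it, and \<open>x - (x \<bullet> e) *\<^sub>R e\<close> the orthogonal projection of \<open>x\<close>
  onto \<open>H\<close>; only the values of \<open>\<phi>\<close> and of its gradient \<open>g\<close> on \<open>H\<close> near the projection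
  of \<open>p\<close> matter. For \<open>n = 1\<close>, \<open>H = {0}\<close> and the set is locally a half-line.\<close>

definition C1_holder_on :: "real \<Rightarrow> 'a::euclidean_space set \<Rightarrow> 'a set \<Rightarrow> ('a \<Rightarrow> real) \<Rightarrow> bool" where
  "C1_holder_on \<gamma> H U \<phi> \<longleftrightarrow>
     (\<exists>(g :: 'a \<Rightarrow> 'a) K.
        (\<forall>y\<in>H \<inter> U. (\<phi> has_derivative (\<lambda>h. g y \<bullet> h)) (at y within H)) \<and>
        (\<forall>y\<in>H \<inter> U. \<forall>z\<in>H \<inter> U. norm (g y - g z) \<le> K * norm (y - z) powr \<gamma>))"

definition C1_holder_boundary :: "real \<Rightarrow> 'a::euclidean_space set \<Rightarrow> bool" where
  "C1_holder_boundary \<gamma> \<Omega> \<longleftrightarrow>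
     (\<forall>p\<in>frontier \<Omega>. \<exists>r>0. \<exists>e \<phi>. norm e = 1 \<and>
        C1_holder_on \<gamma> {y. y \<bullet> e = 0} (ball (p - (p \<bullet> e) *\<^sub>R e) r) \<phi> \<and>
        \<Omega> \<inter> ball p r = {x \<in> ball p r. x \<bullet> e < \<phi> (x - (x \<bullet> e) *\<^sub>R e)})"

section \<open>The fractional perimeter\<close>

text \<open>The value \<open>1 / 0 = 0\<close> of the kernel on the diagonal is irrelevant, since points are null.\<close>

definition interaction :: "real \<Rightarrow> 'a::euclidean_space set \<Rightarrow> 'a set \<Rightarrow> ennreal" where
  "interaction s A B =
     (\<integral>\<^sup>+x\<in>A. (\<integral>\<^sup>+y\<in>B. ennreal (1 / norm (x - y) powr (real DIM('a) + s)) \<partial>lebesgue) \<partial>lebesgue)"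

definition s_perimeter :: "real \<Rightarrow> 'a::euclidean_space set \<Rightarrow> 'a set \<Rightarrow> ennreal" where
  "s_perimeter s E \<Omega> =
     interaction s (E \<inter> \<Omega>) (- E \<inter> \<Omega>) +
     interaction s (E \<inter> \<Omega>) (- E \<inter> - \<Omega>) +
     interaction s (E \<inter> - \<Omega>) (- E \<inter> \<Omega>)"

text \<open>The family \<open>\<E>\<close> of the sets for which the limit \<open>\<mu>\<close> exists as a finite number.\<close>

definition limit_family :: "'a::euclidean_space set \<Rightarrow> 'a set set" where
  "limit_family \<Omega> =
     {E \<in> sets lebesgue. \<exists>l. l < \<infinity> \<and> ((\<lambda>s. ennreal s * s_perimeter s E \<Omega>) \<longlongrightarrow> l) (at_right 0)}"

definition limit_mu :: "'a::euclidean_space set \<Rightarrow> 'a set \<Rightarrow> real" where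
  "limit_mu \<Omega> E = enn2real (Lim (at_right 0) (\<lambda>s. ennreal s * s_perimeter s E \<Omega>))"

definition weighted_tail :: "'a::euclidean_space set \<Rightarrow> real \<Rightarrow> real" where
  "weighted_tail E s =
     s * (LINT y:E \<inter> - ball 0 1|lebesgue. 1 / norm y powr (real DIM('a) + s))"

definition alpha :: "'a::euclidean_space set \<Rightarrow> real" where
  "alpha E = Lim (at_right 0) (weighted_tail E)"

definition alpha_tilde :: "'a::euclidean_space set \<Rightarrow> real" where
  "alpha_tilde E = alpha E / sphere_measure TYPE('a)"

end

theory Submission
  imports Defs
begin

text \<open>On pairs of points at bounded distance the kernel of order \<open>s \<le> s\<^sub>0\<close> is at most a constant
  times the kernel of order \<open>s\<^sub>0\<close>, so finiteness of the \<open>s\<^sub>0\<close>-perimeter makes the short range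
  interactions, multiplied by \<open>s\<close>, vanish in the limit. For \<open>x\<close> in the bounded set \<open>\<Omega>\<close> and \<open>y\<close>
  far away, the distance of \<open>x\<close> and \<open>y\<close> is \<open>norm y\<close> up to a factor close to \<open>1\<close>, so the long
  range interactions are governed by the weighted tails of \<open>E\<close> and of its complement, which add
  up to \<open>n \<omega>\<^sub>n\<close>, where \<open>\<omega>\<^sub>n\<close> is the volume of the unit ball.

  It remains to see that the Hausdorff measure of the unit sphere is \<open>n \<omega>\<^sub>n\<close>. Both inequalities
  compare a small piece of the sphere with the volume of the thin shell over it. An arbitrary piece \<open>C\<close>
  of diameter \<open>d\<close> is handled as in the isodiametric inequality: the shell \<open>S\<close> has at most the volume
  of \<open>(S - S) / 2\<close> (by Prekopa--Leindler), which lies in a cylinder of radius about \<open>d / 2\<close>.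
  Conversely, the Vitali covering lemma covers the sphere efficiently by disjoint caps, whose
  shells contain cylinders of almost the same radius.\<close>

section \<open>The Prekopa--Leindler inequality\<close>

text \<open>Inner regularity is applied to Lebesgue measure restricted to a ball, which is finite;
  the ball is so large that the part of \<open>A\<close> inside it still has measure above
  \<open>c\<close>. Sets of infinite measure are thereby included.\<close>

lemma borel_inner_compact:
  fixes A :: "'a::euclidean_space set"
  assumes A: "A \<in> sets borel" and c: "c < emeasure lborel A"
  obtains K where "compact K" "K \<subseteq> A" "c < emeasure lborel K"
proof -
  have "emeasure lborel A = (SUP n. emeasure lborel (A \<inter> cball 0 (real n)))"
  proof (subst SUP_emeasure_incseq)
    show "range (\<lambda>n. A \<inter> cball 0 (real n)) \<subseteq> sets lborel" using A by auto
    show "incseq (\<lambda>n. A \<inter> cball 0 (real n))" by (auto simp: incseq_def)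
    have "A = (\<Union>n. A \<inter> cball 0 (real n))"
      by (auto simp: real_arch_simple)
    then show "emeasure lborel A = emeasure lborel (\<Union>n. A \<inter> cball 0 (real n))" by simp
  qed
  with c obtain n where n: "c < emeasure lborel (A \<inter> cball 0 (real n))"
    by (auto simp: less_SUP_iff)
  define M where "M = density lborel (indicator (cball 0 (real n) :: 'a set))"
  have M: "emeasure M B = emeasure lborel (B \<inter> cball 0 (real n))" if "B \<in> sets borel" for B
    using that unfolding M_def
    by (subst emeasure_density) (auto intro!: borel_measurable_indicator simp: Int_commute simp flip: indicator_inter_arith)
  have "emeasure M A = (SUP K \<in> {K. K \<subseteq> A \<and> compact K}. emeasure M K)"
  proof (rule inner_regular)
    show "sets M = sets borel" by (simp add: M_def)
    have "emeasure M UNIV \<le> emeasure lborel (cball 0 (real n) :: 'a set)" by (subst M) auto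
    also have "\<dots> < \<infinity>" by (simp add: emeasure_cball)
    finally show "emeasure M (space M) \<noteq> \<infinity>" by (simp add: M_def)
  qed (fact A)
  then have "c < (SUP K \<in> {K. K \<subseteq> A \<and> compact K}. emeasure M K)"
    using n M[OF A] by simp
  then obtain K where K: "K \<subseteq> A" "compact K" "c < emeasure M K"
    unfolding less_SUP_iff by blast
  have "emeasure M K \<le> emeasure lborel K"
    using K by (subst M) (auto intro!: emeasure_mono borel_compact)
  with K show ?thesis by (intro that[of K]) auto
qed

lemma emeasure_lborel_translate:
  fixes A :: "'a::euclidean_space set"
  assumes "A \<in> sets borel"
  shows "(+) c ` A \<in> sets borel" "emeasure lborel ((+) c ` A) = emeasure lborel A"
proof -
  have eq: "(+) c ` A = (\<lambda>x. x - c) -` A" by (force simp: image_iff)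
  have m: "(\<lambda>x. x - c) \<in> borel_measurable borel" by simp
  show 1: "(+) c ` A \<in> sets borel"
    unfolding eq using measurable_sets[OF m assms] by simp
  have "emeasure lborel ((+) c ` A) = emeasure (distr lborel borel ((+) c)) ((+) c ` A)"
    by (simp add: lborel_distr_plus)
  also have "\<dots> = emeasure lborel ((+) c -` (+) c ` A)" 
    using 1 by (subst emeasure_distr) auto
  also have "(+) c -` (+) c ` A = A" by (auto simp: image_iff)
  finally show "emeasure lborel ((+) c ` A) = emeasure lborel A" .
qed

text \<open>With \<open>a\<close> the maximum of \<open>K\<close> and \<open>b\<close> the minimum
  of \<open>L\<close>, the translates \<open>b + K\<close> and \<open>a + L\<close> meet at most in
  the point \<open>a + b\<close>, and both lie in the sumset, hence in \<open>C\<close>.\<close>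

lemma brunn_minkowski_real_compact:
  fixes K L :: "real set"
  assumes "compact K" "K \<noteq> {}" "compact L" "L \<noteq> {}" and C: "C \<in> sets borel"
    and sub: "\<And>x y. x \<in> K \<Longrightarrow> y \<in> L \<Longrightarrow> x + y \<in> C"
  shows "emeasure lborel K + emeasure lborel L \<le> emeasure lborel C"
proof -
  obtain a where a: "a \<in> K" "\<And>x. x \<in> K \<Longrightarrow> x \<le> a"
    using compact_attains_sup[of K] assms by blast
  obtain b where b: "b \<in> L" "\<And>x. x \<in> L \<Longrightarrow> b \<le> x"
    using compact_attains_inf[of L] assms by blast
  have bor: "K \<in> sets borel" "L \<in> sets borel" using assms by (auto intro: borel_compact)
  let ?K = "(+) b ` K" and ?L = "(+) a ` L"
  have "?K \<inter> ?L \<subseteq> {a + b}" 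
  proof clarify
    fix x y assume *: "x \<in> K" "y \<in> L" "b + x = a + y"
    then show "b + x = a + b" using a(2)[of x] b(2)[of y] by linarith
  qed
  then have "emeasure lborel (?K \<inter> ?L) \<le> emeasure lborel {a+b}"
    by (intro emeasure_mono) auto
  then have 0: "emeasure lborel (?K \<inter> ?L) = 0" by simp
  have "emeasure lborel K + emeasure lborel L = emeasure lborel (?K \<union> ?L) + emeasure lborel (?K \<inter> ?L)"
    using bor emeasure_lborel_translate[OF bor(1), of b] emeasure_lborel_translate[OF bor(2), of a]
      emeasure_Un_Int[of ?K lborel ?L] by auto
  also have "\<dots> = emeasure lborel (?K \<union> ?L)" by (simp add: 0)
  also have "\<dots> \<le> emeasure lborel C"
    using C a b sub by (intro emeasure_mono) (auto, metis add.commute)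
  finally show ?thesis .
qed

text \<open>Each set is exhausted from inside by compact sets, one set at a time. A Borel superset
  \<open>C\<close> stands for the sumset, because the sum of two Borel sets need not be
  Borel.\<close>

lemma brunn_minkowski_real:
  fixes A B :: "real set"
  assumes A: "A \<in> sets borel" "A \<noteq> {}" and B: "B \<in> sets borel" "B \<noteq> {}"
    and C: "C \<in> sets borel"
    and sub: "\<And>x y. x \<in> A \<Longrightarrow> y \<in> B \<Longrightarrow> x + y \<in> C"
  shows "emeasure lborel A + emeasure lborel B \<le> emeasure lborel C"
proof -
  \<comment> \<open>The constant \<open>b\<close> is left open so that the step serves twice: first
    with the measure of a compact subset of \<open>B\<close>, then, with the roles exchanged, with
    the measure of \<open>A\<close>. An infinite \<open>b\<close> is treated apart because it cannot
    be subtracted.\<close>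
  have step: "emeasure lborel A + b \<le> emeasure lborel C"
    if A: "A \<in> sets borel" "A \<noteq> {}"
      and *: "\<And>K. compact K \<Longrightarrow> K \<subseteq> A \<Longrightarrow> K \<noteq> {} \<Longrightarrow> emeasure lborel K + b \<le> emeasure lborel C"
    for A :: "real set" and b
  proof (cases "b = \<infinity>")
    case True
    obtain x where "x \<in> A" using A by auto
    then show ?thesis using *[of "{x}"] True by auto
  next
    case False
    obtain x where x: "x \<in> A" using A by auto
    then have bC: "b \<le> emeasure lborel C" using *[of "{x}"] by auto
    have "emeasure lborel A \<le> emeasure lborel C - b"
    proof (rule dense_le)
      fix c assume "c < emeasure lborel A"
      then obtain K where K: "compact K" "K \<subseteq> A" "c < emeasure lborel K"
        using borel_inner_compact[OF A(1)] by metis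
      moreover have "K \<noteq> {}" using K by auto
      ultimately have "emeasure lborel K + b \<le> emeasure lborel C" using * by blast
      then have "emeasure lborel K \<le> emeasure lborel C - b"
        using False by (simp add: ennreal_le_minus_iff add.commute)
      with K show "c \<le> emeasure lborel C - b" by simp
    qed
    then have "emeasure lborel A + b \<le> (emeasure lborel C - b) + b" by (rule add_right_mono)
    also have "\<dots> = emeasure lborel C" using bC by (simp add: diff_add_cancel_ennreal)
    finally show ?thesis .
  qed
  have "emeasure lborel A + emeasure lborel L \<le> emeasure lborel C" 
    if "compact L" "L \<subseteq> B" "L \<noteq> {}" for L
    using that sub by (intro step[OF A] brunn_minkowski_real_compact C) auto
  then have "emeasure lborel B + emeasure lborel A \<le> emeasure lborel C"
    by (intro step[OF B]) (simp add: add.commute)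
  then show ?thesis by (simp add: add.commute)
qed

section \<open>The Prekopa--Leindler inequality on the line, by way of superlevel sets\<close>

text \<open>The value \<open>f x\<close> is the length of the set of all \<open>t \<ge> 0\<close>
  strictly below it, also when it is infinite; Fubini's theorem then exchanges the two
  integrals.\<close>

lemma nn_integral_layer_cake:
  assumes "sigma_finite_measure M" and f[measurable]: "f \<in> borel_measurable M"
  shows "(\<integral>\<^sup>+x. f x \<partial>M) = (\<integral>\<^sup>+t\<in>{0..}. emeasure M {x\<in>space M. ennreal t < f x} \<partial>lborel)"
proof -
  interpret M: sigma_finite_measure M by fact
  interpret pair_sigma_finite M "lborel :: real measure" ..
  have len: "(\<integral>\<^sup>+t. indicator {t. 0 \<le> t \<and> ennreal t < u} t \<partial>lborel) = u" for u
  proof (cases u)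
    case (real r)
    then have "{t. 0 \<le> t \<and> ennreal t < u} = {0..<r}" by (auto simp: ennreal_less_iff)
    then show ?thesis using real by simp
  next
    case top
    then have "{t. 0 \<le> t \<and> ennreal t < u} = {0..}" by auto
    moreover have "emeasure lborel {0::real..} = \<infinity>"
    proof (rule ccontr)
      assume "emeasure lborel {0::real..} \<noteq> \<infinity>"
      then obtain r where r: "emeasure lborel {0::real..} = ennreal r" "r \<ge> 0"
        by (cases "emeasure lborel {0::real..}") auto
      moreover have "emeasure lborel {0..r+1} \<le> emeasure lborel {0::real..}"
        by (intro emeasure_mono) auto
      ultimately show False by simp
    qed
    ultimately show ?thesis using top by simp
  qed
  have "(\<integral>\<^sup>+x. f x \<partial>M) = (\<integral>\<^sup>+x. \<integral>\<^sup>+t. indicator {t. 0 \<le> t \<and> ennreal t < f x} t \<partial>lborel \<partial>M)"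
    by (simp add: len del: nn_integral_indicator)
  also have "\<dots> = (\<integral>\<^sup>+t. \<integral>\<^sup>+x. indicator {t. 0 \<le> t \<and> ennreal t < f x} t \<partial>M \<partial>lborel)"
    by (rule Fubini'[symmetric]) (auto simp: measurable_split_conv)
  also have "\<dots> = (\<integral>\<^sup>+t\<in>{0..}. emeasure M {x\<in>space M. ennreal t < f x} \<partial>lborel)"
  proof (rule nn_integral_cong)
    fix t :: real
    show "(\<integral>\<^sup>+x. indicator {t. 0 \<le> t \<and> ennreal t < f x} t \<partial>M)
      = emeasure M {x\<in>space M. ennreal t < f x} * indicator {0..} t"
      by (subst nn_integral_indicator[symmetric], measurable, subst nn_integral_multc[symmetric])
         (auto intro!: nn_integral_cong simp: indicator_def)
  qed
  finally show ?thesis .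
qed

text \<open>Both \<open>a\<close> and \<open>c\<close> are finite, being strictly below something,
  and both right-hand factors are positive, so an infinite factor there makes the right-hand product
  infinite.\<close>

lemma ennreal_mult_strict_mono:
  fixes a b c d :: ennreal
  assumes "a < b" "c < d"
  shows "a * c < b * d"
proof -
  obtain a' c' where [simp]: "a = ennreal a'" "c = ennreal c'" "a' \<ge> 0" "c' \<ge> 0"
    using assms by (cases a; cases c) auto
  show ?thesis
  proof (cases "b = top \<or> d = top")
    case True
    then have "b * d = top" using assms by (auto simp: ennreal_mult_eq_top_iff)
    then show ?thesis by (simp flip: ennreal_mult')
  next
    case False
    then obtain b' d' where [simp]: "b = ennreal b'" "d = ennreal d'" "b' \<ge> 0" "d' \<ge> 0"
      by (cases b; cases d) auto
    have "a' * c' < b' * d'" using assms by (intro mult_strict_mono') (auto simp: ennreal_less_iff)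
    then show ?thesis by (simp add: ennreal_less_iff flip: ennreal_mult')
  qed
qed

text \<open>For \<open>t < 1\<close> both superlevel sets are nonempty, which is what the one-dimensional
  Brunn--Minkowski inequality needs; without the normalisation this fails.\<close>

lemma prekopa_leindler_real_normalized:
  fixes f g h :: "real \<Rightarrow> ennreal"
  assumes [measurable]: "f \<in> borel_measurable borel" "g \<in> borel_measurable borel" "h \<in> borel_measurable borel"
    and fgh: "\<And>x y. f x * g y \<le> (h ((x + y) / 2))\<^sup>2"
    and sup: "(SUP x. f x) = 1" "(SUP x. g x) = 1"
  shows "(\<integral>\<^sup>+x. f x \<partial>lborel) + (\<integral>\<^sup>+x. g x \<partial>lborel) \<le> 2 * (\<integral>\<^sup>+x. h x \<partial>lborel)"
proof -
  have sf: "sigma_finite_measure (lborel :: real measure)" by (rule sigma_finite_lborel)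
  let ?S = "\<lambda>f t. {x::real. ennreal t < f x}"
  have le1: "f x \<le> 1" "g x \<le> 1" for x
    using sup by (metis SUP_upper UNIV_I)+
  have *: "emeasure lborel (?S f t) + emeasure lborel (?S g t) \<le> 2 * emeasure lborel (?S h t)"
    if "t \<ge> 0" for t
  proof (cases "t < 1")
    case False
    then have "?S f t = {}" "?S g t = {}"
      using le1 by (auto simp: not_less intro: order.trans[OF le1(1)] order.trans[OF le1(2)])
    then show ?thesis by simp
  next
    case True
    then have t1: "ennreal t < 1" using that by (simp add: ennreal_less_one_iff)
    have ne: "?S f t \<noteq> {}" "?S g t \<noteq> {}"
      using t1 less_SUP_iff[of "ennreal t" f UNIV] less_SUP_iff[of "ennreal t" g UNIV]
      by (auto simp: sup)
    \<comment> \<open>The midpoint of a point where \<open>f\<close> exceeds \<open>t\<close> and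
      one where \<open>g\<close> does is a point where \<open>h\<close> exceeds \<open>t\<close>; so
      the sumset lies in the superlevel set of \<open>h\<close> dilated by 2.\<close>
    have "emeasure lborel (?S f t) + emeasure lborel (?S g t)
        \<le> emeasure lborel ((\<lambda>z. z / 2) -` ?S h t)"
    proof (rule brunn_minkowski_real[OF _ ne(1) _ ne(2)])
      show "(\<lambda>z. z / 2) -` ?S h t \<in> sets borel"
        by (rule measurable_sets_borel[where M=borel]) auto
      fix x y assume xy: "x \<in> ?S f t" "y \<in> ?S g t"
      have "(ennreal t)\<^sup>2 < f x * g y"
        using xy unfolding power2_eq_square mem_Collect_eq by (rule ennreal_mult_strict_mono)
      also note fgh
      finally have "ennreal t < h ((x + y) / 2)"
        by (meson not_le power_mono zero_le)
      then show "x + y \<in> (\<lambda>z. z / 2) -` ?S h t" by simp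
    qed auto
    also have "\<dots> = emeasure (distr lborel borel (\<lambda>z. z / 2)) (?S h t)"
      by (subst emeasure_distr) auto
    also have "distr lborel borel (\<lambda>z::real. z / 2) = distr lborel borel ((*) (1/2))"
      by (rule arg_cong[where f="distr lborel borel"]) auto
    also have "\<dots> = density lborel (\<lambda>_. ennreal 2)"
      by (subst lborel_distr_mult) auto
    also have "emeasure \<dots> (?S h t) = 2 * emeasure lborel (?S h t)"
      by (subst emeasure_density_const) auto
    finally show ?thesis .
  qed
  have "(\<integral>\<^sup>+x. f x \<partial>lborel) + (\<integral>\<^sup>+x. g x \<partial>lborel)
    = (\<integral>\<^sup>+t. (emeasure lborel (?S f t) + emeasure lborel (?S g t)) * indicator {0..} t \<partial>lborel)"
    unfolding nn_integral_layer_cake[OF sf, of f, simplified] nn_integral_layer_cake[OF sf, of g, simplified]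
    by (subst nn_integral_add[symmetric]) (auto simp: distrib_right)
  also have "\<dots> \<le> (\<integral>\<^sup>+t. 2 * (emeasure lborel (?S h t) * indicator {0..} t) \<partial>lborel)"
    using * by (intro nn_integral_mono) (auto simp: indicator_def)
  also have "\<dots> = 2 * (\<integral>\<^sup>+x. h x \<partial>lborel)"
    unfolding nn_integral_layer_cake[OF sf, of h, simplified] by (subst nn_integral_cmult) auto
  finally show ?thesis .
qed

lemma ennreal_am_gm:
  fixes a b c :: ennreal
  assumes "a + b \<le> 2 * c"
  shows "a * b \<le> c\<^sup>2"
proof (cases "c = \<infinity>")
  case False
  with assms have "a \<noteq> \<infinity>" "b \<noteq> \<infinity>"
    by (auto simp: top_unique ennreal_mult_eq_top_iff)
  then obtain a' b' c' where r: "a = ennreal a'" "b = ennreal b'" "c = ennreal c'"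
      "a' \<ge> 0" "b' \<ge> 0" "c' \<ge> 0"
    using False by (cases a; cases b; cases c) auto
  then have "a' + b' \<le> 2 * c'"
    using assms by (simp flip: ennreal_plus ennreal_mult' ennreal_numeral)
  then have "(a' + b')\<^sup>2 \<le> (2 * c')\<^sup>2" using r by (intro power_mono) auto
  moreover have "4 * (a' * b') \<le> (a' + b')\<^sup>2"
    using sum_squares_bound[of a' b'] by (simp add: power2_eq_square algebra_simps)
  ultimately have "a' * b' \<le> c'\<^sup>2" by (simp add: power_mult_distrib)
  then show ?thesis using r by (simp add: ennreal_power flip: ennreal_mult')
qed auto

text \<open>Dividing \<open>f\<close> and \<open>g\<close> by their suprema, and \<open>h\<close> by
  the geometric mean of the suprema, preserves the hypothesis and leads to the normalised case; the
  bound \<open>B\<close> makes the suprema finite. The inequality of arithmetic and geometric means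
  turns the sum obtained there into a product.\<close>

lemma prekopa_leindler_real_bounded:
  fixes f g h :: "real \<Rightarrow> ennreal"
  assumes meas[measurable]: "f \<in> borel_measurable borel" "g \<in> borel_measurable borel" "h \<in> borel_measurable borel"
    and fgh: "\<And>x y. f x * g y \<le> (h ((x + y) / 2))\<^sup>2"
    and bd: "\<And>x. f x \<le> ennreal B" "\<And>x. g x \<le> ennreal B"
  shows "(\<integral>\<^sup>+x. f x \<partial>lborel) * (\<integral>\<^sup>+x. g x \<partial>lborel) \<le> (\<integral>\<^sup>+x. h x \<partial>lborel)\<^sup>2"
proof (cases "(SUP x. f x) = 0 \<or> (SUP x. g x) = 0")
  case True
  then have "(\<forall>x. f x = 0) \<or> (\<forall>x. g x = 0)" by (auto simp: SUP_eq_iff bot_ennreal[symmetric])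
  then show ?thesis by auto
next
  case False
  have "(SUP x. f x) \<le> ennreal B" "(SUP x. g x) \<le> ennreal B" using bd by (auto intro: SUP_least)
  then have "(SUP x. f x) \<noteq> top" "(SUP x. g x) \<noteq> top" by (metis ennreal_neq_top top_unique)+
  then obtain a b where ab: "(SUP x. f x) = ennreal a" "(SUP x. g x) = ennreal b" "a > 0" "b > 0"
    using False by (cases "SUP x. f x"; cases "SUP x. g x") (auto simp: less_le)
  define c where "c = sqrt (a * b)"
  have c: "c > 0" "c\<^sup>2 = a * b" using ab by (auto simp: c_def)
  let ?f = "\<lambda>x. ennreal (1/a) * f x" and ?g = "\<lambda>x. ennreal (1/b) * g x"
    and ?h = "\<lambda>x. ennreal (1/c) * h x"
  have "(\<integral>\<^sup>+x. ?f x \<partial>lborel) + (\<integral>\<^sup>+x. ?g x \<partial>lborel) \<le> 2 * (\<integral>\<^sup>+x. ?h x \<partial>lborel)"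
  proof (rule prekopa_leindler_real_normalized)
    fix x y
    have "?f x * ?g y = ennreal (1/c)^2 * (f x * g y)"
      using c ab by (simp add: ennreal_power power_divide mult_ac flip: ennreal_mult' mult.assoc)
    also have "\<dots> \<le> ennreal (1/c)^2 * (h ((x+y)/2))\<^sup>2"
      by (intro mult_left_mono fgh) auto
    finally show "?f x * ?g y \<le> (?h ((x+y)/2))\<^sup>2" by (simp add: power_mult_distrib)
  next
    show "(SUP x. ?f x) = 1" "(SUP x. ?g x) = 1"
      using ab by (simp_all add: SUP_mult_left_ennreal[symmetric] flip: ennreal_mult')
  qed auto
  then have "ennreal (1/a) * (\<integral>\<^sup>+x. f x \<partial>lborel) + ennreal (1/b) * (\<integral>\<^sup>+x. g x \<partial>lborel)
      \<le> 2 * (ennreal (1/c) * (\<integral>\<^sup>+x. h x \<partial>lborel))"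
    by (simp add: nn_integral_cmult)
  from ennreal_am_gm[OF this]
  have "(ennreal c)\<^sup>2 * ((ennreal (1/a) * (\<integral>\<^sup>+x. f x \<partial>lborel)) * (ennreal (1/b) * (\<integral>\<^sup>+x. g x \<partial>lborel)))
     \<le> (ennreal c)\<^sup>2 * (ennreal (1/c) * (\<integral>\<^sup>+x. h x \<partial>lborel))\<^sup>2"
    by (intro mult_left_mono) auto
  moreover have "(ennreal c)\<^sup>2 * ((ennreal (1/a) * F) * (ennreal (1/b) * G)) = F * G" for F G
  proof -
    have "(ennreal c)\<^sup>2 * ((ennreal (1/a) * F) * (ennreal (1/b) * G))
       = ((ennreal c)\<^sup>2 * ennreal (1/a) * ennreal (1/b)) * (F * G)" by (simp add: mult_ac)
    also have "(ennreal c)\<^sup>2 * ennreal (1/a) * ennreal (1/b) = 1"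
      using c ab by (simp add: ennreal_power flip: ennreal_mult')
    finally show ?thesis by simp
  qed
  moreover have "(ennreal c)\<^sup>2 * (ennreal (1/c) * H)\<^sup>2 = H\<^sup>2" for H
  proof -
    have "(ennreal c)\<^sup>2 * (ennreal (1/c) * H)\<^sup>2 = (ennreal c * ennreal (1/c))\<^sup>2 * H\<^sup>2"
      by (simp add: power_mult_distrib mult_ac)
    also have "ennreal c * ennreal (1/c) = 1" using c by (simp flip: ennreal_mult')
    finally show ?thesis by simp
  qed
  ultimately show ?thesis by simp
qed

lemma nn_integral_SUP_min:
  fixes f :: "real \<Rightarrow> ennreal"
  assumes [measurable]: "f \<in> borel_measurable borel"
  shows "(\<integral>\<^sup>+x. f x \<partial>lborel) = (SUP n. \<integral>\<^sup>+x. min (f x) (ennreal (real n)) \<partial>lborel)"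
proof -
  have "(\<integral>\<^sup>+x. f x \<partial>lborel) = (\<integral>\<^sup>+x. (SUP n. min (f x) (ennreal (real n))) \<partial>lborel)"
  proof (rule nn_integral_cong)
    fix x
    have "(SUP n. min (f x) (ennreal (real n))) = min (f x) (SUP n. ennreal (real n))"
      by (simp add: min_def flip: inf_min inf_SUP)
    also have "(SUP n. ennreal (real n)) = top"
      using ennreal_SUP_of_nat_eq_top by (simp only: ennreal_of_nat_eq_real_of_nat)
    finally show "f x = (SUP n. min (f x) (ennreal (real n)))" by simp
  qed
  also have "\<dots> = (SUP n. \<integral>\<^sup>+x. min (f x) (ennreal (real n)) \<partial>lborel)"
    by (intro nn_integral_monotone_convergence_SUP)
       (auto simp: incseq_def le_fun_def intro!: min.mono ennreal_leI simp del: min.bounded_iff)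
  finally show ?thesis .
qed

text \<open>Truncations of \<open>f\<close> and \<open>g\<close> satisfy the hypothesis with the
  same \<open>h\<close>. The two truncation levels then tend to infinity independently, by monotone
  convergence.\<close>

lemma prekopa_leindler_real:
  fixes f g h :: "real \<Rightarrow> ennreal"
  assumes meas[measurable]: "f \<in> borel_measurable borel" "g \<in> borel_measurable borel" "h \<in> borel_measurable borel"
    and fgh: "\<And>x y. f x * g y \<le> (h ((x + y) / 2))\<^sup>2"
  shows "(\<integral>\<^sup>+x. f x \<partial>lborel) * (\<integral>\<^sup>+x. g x \<partial>lborel) \<le> (\<integral>\<^sup>+x. h x \<partial>lborel)\<^sup>2"
proof -
  let ?I = "\<lambda>(f :: real \<Rightarrow> ennreal) n. \<integral>\<^sup>+x. min (f x) (ennreal (real n)) \<partial>lborel"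
  have "?I f m * ?I g n \<le> (\<integral>\<^sup>+x. h x \<partial>lborel)\<^sup>2" for m n
  proof (rule prekopa_leindler_real_bounded[where B="real (max m n)"])
    fix x y
    have "min (f x) (ennreal (real m)) * min (g y) (ennreal (real n)) \<le> f x * g y"
      by (intro mult_mono) auto
    then show "min (f x) (ennreal (real m)) * min (g y) (ennreal (real n)) \<le> (h ((x + y) / 2))\<^sup>2"
      using fgh order.trans by blast
  qed (auto simp: min_le_iff_disj intro!: disjI2 ennreal_leI)
  then show ?thesis
    unfolding nn_integral_SUP_min[OF meas(1)] nn_integral_SUP_min[OF meas(2)]
    by (auto simp: SUP_mult_left_ennreal SUP_mult_right_ennreal intro!: SUP_least)
qed

section \<open>Passage to higher dimensions, and the half difference set\<close>

text \<open>Induction on the coordinates: the induction hypothesis for the slices at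
  \<open>s\<close>, \<open>t\<close> and \<open>(s + t) / 2\<close> says exactly that the partial
  integrals satisfy the one-dimensional hypothesis. Points are required to be
  \<open>extensional\<close> because elements of the product space are fixed outside
  \<open>I\<close>.\<close>

lemma prekopa_leindler_PiM:
  fixes f g h :: "('i \<Rightarrow> real) \<Rightarrow> ennreal"
  assumes "finite I"
    and "f \<in> borel_measurable (Pi\<^sub>M I (\<lambda>_. lborel))" "g \<in> borel_measurable (Pi\<^sub>M I (\<lambda>_. lborel))"
      "h \<in> borel_measurable (Pi\<^sub>M I (\<lambda>_. lborel))"
    and "\<And>x y. x \<in> extensional I \<Longrightarrow> y \<in> extensional I \<Longrightarrow> f x * g y \<le> (h (\<lambda>i\<in>I. (x i + y i) / 2))\<^sup>2"
  shows "(\<integral>\<^sup>+x. f x \<partial>Pi\<^sub>M I (\<lambda>_. lborel)) * (\<integral>\<^sup>+x. g x \<partial>Pi\<^sub>M I (\<lambda>_. lborel))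
    \<le> (\<integral>\<^sup>+x. h x \<partial>Pi\<^sub>M I (\<lambda>_. lborel))\<^sup>2"
  using assms
proof (induction I arbitrary: f g h)
  case empty
  have "(\<lambda>i\<in>{}. (undefined + undefined) / 2) = (\<lambda>_. undefined :: real)" by (auto simp: restrict_def)
  then show ?case using empty(4)[of "\<lambda>_. undefined" "\<lambda>_. undefined"] 
    by (simp add: product_sigma_finite.nn_integral_empty product_sigma_finite_def sigma_finite_lborel restrict_def)
next
  case (insert i I f g h)
  interpret product_sigma_finite "\<lambda>_::'i. lborel :: real measure" by standard
  note insert.prems(1-3)[measurable]
  note [simp] = insert.hyps
  have m: "(\<lambda>x. f (x(i := y))) \<in> borel_measurable (Pi\<^sub>M I (\<lambda>_. lborel))" 
    if [measurable]: "f \<in> borel_measurable (Pi\<^sub>M (insert i I) (\<lambda>_. lborel))"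
    for f :: "('i \<Rightarrow> real) \<Rightarrow> ennreal" and y :: real
    by measurable
  have m2: "(\<lambda>y. \<integral>\<^sup>+x. f (x(i := y)) \<partial>Pi\<^sub>M I (\<lambda>_. lborel)) \<in> borel_measurable borel" 
    if [measurable]: "f \<in> borel_measurable (Pi\<^sub>M (insert i I) (\<lambda>_. lborel))"
    for f :: "('i \<Rightarrow> real) \<Rightarrow> ennreal"
  proof -
    interpret P: finite_product_sigma_finite "\<lambda>_::'i. lborel :: real measure" I by standard simp
    have "(\<lambda>y. \<integral>\<^sup>+x. f (x(i := y)) \<partial>Pi\<^sub>M I (\<lambda>_. lborel)) \<in> borel_measurable lborel"
      by (rule P.borel_measurable_nn_integral) measurable
    then show ?thesis by simp
  qed
  show ?case
    unfolding product_nn_integral_insert_rev[OF insert.hyps insert.prems(1)]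
      product_nn_integral_insert_rev[OF insert.hyps insert.prems(2)]
      product_nn_integral_insert_rev[OF insert.hyps insert.prems(3)]
  proof (rule prekopa_leindler_real)
    fix s t :: real
    show "(\<integral>\<^sup>+x. f (x(i := s)) \<partial>Pi\<^sub>M I (\<lambda>_. lborel)) * (\<integral>\<^sup>+x. g (x(i := t)) \<partial>Pi\<^sub>M I (\<lambda>_. lborel))
      \<le> (\<integral>\<^sup>+x. h (x(i := (s + t) / 2)) \<partial>Pi\<^sub>M I (\<lambda>_. lborel))\<^sup>2"
    proof (rule insert.IH)
      fix x y :: "'i \<Rightarrow> real" assume xy: "x \<in> extensional I" "y \<in> extensional I"
      have e: "x(i := s) \<in> extensional (insert i I)" "y(i := t) \<in> extensional (insert i I)"
        using xy by (auto simp: extensional_def)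
      have eq: "(\<lambda>j\<in>insert i I. ((x(i := s)) j + (y(i := t)) j) / 2)
          = (\<lambda>j\<in>I. (x j + y j) / 2)(i := (s + t) / 2)"
        by (auto simp: restrict_def fun_eq_iff)
      show "f (x(i := s)) * g (y(i := t)) \<le> (h ((\<lambda>j\<in>I. (x j + y j) / 2)(i := (s + t) / 2)))\<^sup>2"
        using insert.prems(4)[OF e] unfolding eq .
    qed (intro m insert.prems)+
  qed (intro m2 insert.prems)+
qed

text \<open>The Prekopa--Leindler inequality is applied to the indicators of \<open>A\<close>, of
  its reflection \<open>- A\<close>, and of \<open>D\<close>; the midpoint of \<open>x\<close> and
  \<open>- y\<close> is half of \<open>x - y\<close>. Since \<open>- A\<close> has the same volume
  as \<open>A\<close>, this compares the squares of the two volumes.\<close>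

lemma emeasure_le_half_difference:
  fixes A D :: "'a::euclidean_space set"
  assumes A: "compact A" and D[measurable]: "D \<in> sets borel"
    and sub: "\<And>x y. x \<in> A \<Longrightarrow> y \<in> A \<Longrightarrow> (1/2) *\<^sub>R (x - y) \<in> D"
  shows "emeasure lborel A \<le> emeasure lborel D"
proof -
  let ?P = "Pi\<^sub>M (Basis :: 'a set) (\<lambda>_. lborel :: real measure)"
  let ?T = "\<lambda>f. \<Sum>b\<in>Basis. f b *\<^sub>R b :: 'a"
  have A'[measurable]: "A \<in> sets borel" using A by (rule borel_compact)
  let ?A' = "uminus -` A"
  have mA'[measurable]: "?A' \<in> sets borel" by (rule measurable_sets_borel[OF _ A']) simp
  have tr: "emeasure lborel S = (\<integral>\<^sup>+x. indicator S (?T x) \<partial>?P)" if [measurable]: "S \<in> sets borel" for S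
  proof -
    have "emeasure lborel S = (\<integral>\<^sup>+x. indicator S x \<partial>lborel)" by simp
    also have "\<dots> = (\<integral>\<^sup>+x. indicator S (?T x) \<partial>?P)"
      by (subst lborel_eq, subst nn_integral_distr) auto
    finally show ?thesis .
  qed
  have neg: "emeasure lborel ?A' = emeasure lborel A"
  proof -
    have "(uminus :: 'a \<Rightarrow> 'a) = (\<lambda>x. 0 + (-1) *\<^sub>R x)" by auto
    then have "distr lborel borel (uminus :: 'a \<Rightarrow> 'a) = lborel"
      using lborel_affine[of "-1" "0::'a"] by (simp add: density_1)
    then have "emeasure lborel A = emeasure (distr lborel borel uminus) A" by simp
    then show ?thesis by (subst (asm) emeasure_distr) auto
  qed
  have "emeasure lborel A * emeasure lborel ?A' \<le> (emeasure lborel D)\<^sup>2"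
    unfolding tr[OF A'] tr[OF mA'] tr[OF D]
  proof (rule prekopa_leindler_PiM)
    fix x y
    have "?T (\<lambda>i\<in>Basis. (x i + y i) / 2) = (1/2) *\<^sub>R (?T x - (- ?T y))"
      by (simp add: scaleR_sum_right sum.distrib[symmetric] scaleR_add_left[symmetric] add_divide_distrib)
    then show "indicator A (?T x) * indicator ?A' (?T y) \<le> ((indicator D (?T (\<lambda>i\<in>Basis. (x i + y i) / 2)))\<^sup>2 :: ennreal)"
      using sub[of "?T x" "- ?T y"] by (auto simp: indicator_def)
  qed auto
  then have "(emeasure lborel A)\<^sup>2 \<le> (emeasure lborel D)\<^sup>2" by (simp add: neg power2_eq_square)
  \<comment> \<open>A strict inequality between the volumes would carry over to their
    squares.\<close>
  then show ?thesis
    unfolding power2_eq_square by (meson ennreal_mult_strict_mono not_le)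
qed

section \<open>Rotation invariance and the volume of cylinders\<close>

text \<open>Translation invariance and Fubini's theorem, applied to the product of the image measure of \<open>A\<close>
  with the volume of the unit ball, show that the two measures are proportional; both give the
  same value to the ball.\<close>

lemma lborel_distr_orthogonal_transformation:
  fixes f :: "'a::euclidean_space \<Rightarrow> 'a"
  assumes f: "orthogonal_transformation f"
  shows "distr lborel borel f = lborel"
proof (rule measure_eqI)
  have lin: "linear f" using f by (simp add: orthogonal_transformation_linear)
  have norm_f: "norm (f x) = norm x" for x using f by (simp add: orthogonal_transformation)
  have f_inv: "f (inv f y) = y" for y
    using orthogonal_transformation_surj[OF f] by (rule surj_f_inv_f)
  have mf[measurable]: "f \<in> borel_measurable borel"
    by (intro borel_measurable_continuous_onI linear_continuous_on linear_linear[THEN iffD2] lin)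
  fix A assume "A \<in> sets (distr lborel borel f)"
  then have A[measurable]: "A \<in> sets borel" by simp
  let ?B = "cball 0 1 :: 'a set"
  have [measurable]: "?B \<in> sets borel" by simp
  have transl: "(\<integral>\<^sup>+x. u (x + c) \<partial>lborel) = (\<integral>\<^sup>+x. u x \<partial>lborel)"
    if [measurable]: "u \<in> borel_measurable borel" for u :: "'a \<Rightarrow> ennreal" and c
  proof -
    have "(\<integral>\<^sup>+x. u x \<partial>lborel) = (\<integral>\<^sup>+x. u x \<partial>distr lborel borel ((+) c))"
      by (simp add: lborel_distr_plus)
    then show ?thesis by (subst (asm) nn_integral_distr) (auto simp: add.commute)
  qed
  have vol: "(\<integral>\<^sup>+x. indicator ?B (- f x) \<partial>lborel) = emeasure lborel ?B"
  proof -
    have "indicator ?B (- f x) = (indicator ?B x :: ennreal)" for x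
      by (simp add: indicator_def norm_f)
    then show ?thesis by simp
  qed
  have "emeasure (distr lborel borel f) A * emeasure lborel ?B
      = (\<integral>\<^sup>+x. indicator A (f x) \<partial>lborel) * emeasure lborel ?B"
    by (subst nn_integral_indicator[symmetric], simp, subst nn_integral_distr) auto
  also have "\<dots> = (\<integral>\<^sup>+x. indicator A (f x) * (\<integral>\<^sup>+y. indicator ?B (y + (- f x)) \<partial>lborel) \<partial>lborel)"
    by (subst transl) (auto simp: nn_integral_multc intro!: borel_measurable_indicator)
  also have "\<dots> = (\<integral>\<^sup>+x. \<integral>\<^sup>+y. indicator A (f x) * indicator ?B (y - f x) \<partial>lborel \<partial>lborel)"
    by (subst nn_integral_cmult[symmetric]) auto
  also have "\<dots> = (\<integral>\<^sup>+y. \<integral>\<^sup>+x. indicator A (f x) * indicator ?B (y - f x) \<partial>lborel \<partial>lborel)"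
    by (rule lborel_pair.Fubini') measurable
  also have "\<dots> = (\<integral>\<^sup>+y. \<integral>\<^sup>+x. indicator A (f x + y) * indicator ?B (- f x) \<partial>lborel \<partial>lborel)"
  proof (rule nn_integral_cong)
    \<comment> \<open>Translating \<open>x\<close> by the preimage of \<open>y\<close> moves
      \<open>y\<close> out of the factor belonging to the ball and into the one belonging to
      \<open>A\<close>.\<close>
    fix y
    have "(\<integral>\<^sup>+x. indicator A (f x) * indicator ?B (y - f x) \<partial>lborel)
        = (\<integral>\<^sup>+x. indicator A (f (x + inv f y)) * indicator ?B (y - f (x + inv f y)) \<partial>lborel)"
      by (rule transl[symmetric]) measurable
    then show "(\<integral>\<^sup>+x. indicator A (f x) * indicator ?B (y - f x) \<partial>lborel)
        = (\<integral>\<^sup>+x. indicator A (f x + y) * indicator ?B (- f x) \<partial>lborel)"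
      by (simp add: linear_add[OF lin] f_inv)
  qed
  also have "\<dots> = (\<integral>\<^sup>+x. \<integral>\<^sup>+y. indicator A (f x + y) * indicator ?B (- f x) \<partial>lborel \<partial>lborel)"
    by (rule lborel_pair.Fubini') measurable
  also have "\<dots> = (\<integral>\<^sup>+x. (\<integral>\<^sup>+y. indicator A (y + f x) \<partial>lborel) * indicator ?B (- f x) \<partial>lborel)"
    by (subst nn_integral_multc[symmetric]) (auto simp: add.commute)
  also have "\<dots> = (\<integral>\<^sup>+x. emeasure lborel A * indicator ?B (- f x) \<partial>lborel)"
    by (subst transl) auto
  also have "\<dots> = emeasure lborel A * emeasure lborel ?B"
    by (subst nn_integral_cmult) (auto simp: vol)
  finally show "emeasure (distr lborel borel f) A = emeasure lborel A"
    using unit_ball_vol_pos[of "real DIM('a)", THEN less_imp_neq]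
    by (auto simp add: emeasure_cball mult.commute[of _ "ennreal _"] ennreal_mult_cancel_left)
qed simp

text \<open>The map is the reflection in the hyperplane orthogonal to \<open>a - b\<close>; for
  \<open>a = b\<close> the vector \<open>v\<close> vanishes and the map is the identity.\<close>

lemma orthogonal_transformation_unit_vectors:
  fixes a b :: "'a::euclidean_space"
  assumes "norm a = norm b"
  obtains f where "orthogonal_transformation f" "f a = b"
proof -
  define v where "v = a - b"
  define f where "f x = x - (2 * (x \<bullet> v) / (v \<bullet> v)) *\<^sub>R v" for x
  have "linear f" unfolding f_def
    by (intro linearI) (auto simp: inner_add_left algebra_simps add_divide_distrib)
  moreover have "f x \<bullet> f y = x \<bullet> y" for x y
    by (cases "v = 0") (auto simp: f_def inner_diff_left inner_diff_right inner_commute field_simps)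
  moreover have "f a = b"
  proof (cases "a = b")
    case False
    have "a \<bullet> a = b \<bullet> b" using assms by (simp add: dot_square_norm)
    then have "2 * (a \<bullet> v) = v \<bullet> v"
      by (simp add: v_def inner_diff_left inner_diff_right inner_commute)
    moreover have "v \<noteq> 0" using False by (simp add: v_def)
    ultimately show ?thesis by (simp add: f_def) (simp add: v_def)
  qed (simp add: f_def v_def)
  ultimately show ?thesis using that by (auto simp: orthogonal_transformation_def)
qed

definition cylinder :: "'a::euclidean_space \<Rightarrow> real \<Rightarrow> real \<Rightarrow> real \<Rightarrow> 'a set" where
  "cylinder e r a b = {x. norm (x - (x \<bullet> e) *\<^sub>R e) \<le> r \<and> a \<le> x \<bullet> e \<and> x \<bullet> e \<le> b}"

lemma cylinder_borel [measurable]: "cylinder e r a b \<in> sets borel"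
  unfolding cylinder_def by measurable

text \<open>In coordinates the cylinder is the product of a ball in the coordinates other than
  \<open>e\<close> and an interval in the coordinate \<open>e\<close>, so Fubini's theorem gives the
  volume.\<close>

lemma emeasure_cylinder_Basis:
  fixes e :: "'a::euclidean_space"
  assumes e: "e \<in> Basis" and r: "r > 0" and ab: "a \<le> b"
  shows "emeasure lborel (cylinder e r a b)
    = ennreal (unit_ball_vol (real (DIM('a) - 1)) * r ^ (DIM('a) - 1) * (b - a))"
proof -
  interpret product_sigma_finite "\<lambda>_::'a. lborel :: real measure" by standard
  let ?J = "Basis - {e}" and ?T = "\<lambda>f. \<Sum>b\<in>Basis. f b *\<^sub>R b :: 'a"
  let ?Q = "Pi\<^sub>M ?J (\<lambda>_. lborel :: real measure)"
  let ?D = "{f. sqrt (\<Sum>i\<in>?J. (f i)\<^sup>2) \<le> r} \<inter> space ?Q"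
  have ins: "insert e ?J = Basis" using e by auto
  have D[measurable]: "?D \<in> sets ?Q" by measurable
  have mem: "?T (x(e := y)) \<in> cylinder e r a b \<longleftrightarrow> sqrt (\<Sum>i\<in>?J. (x i)\<^sup>2) \<le> r \<and> y \<in> {a..b}" for x y
  proof -
    have 1: "?T (x(e := y)) \<bullet> e = y"
      using e by (subst inner_sum_left_Basis) auto
    have T: "?T (x(e := y)) - y *\<^sub>R e = ?T (x(e := 0))"
    proof -
      have "?T (x(e := z)) = z *\<^sub>R e + (\<Sum>b\<in>?J. x b *\<^sub>R b)" for z
        using e by (subst ins[symmetric], subst sum.insert) auto
      then show ?thesis by simp
    qed
    have "norm (?T (x(e := 0))) = sqrt (\<Sum>i\<in>Basis. ((x(e := 0)) i)\<^sup>2)"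
      using euclidean_dist_l2[of 0 "?T (x(e := 0))"] by (simp add: L2_set_def)
    also have "(\<Sum>i\<in>Basis. ((x(e := 0)) i)\<^sup>2) = (\<Sum>i\<in>?J. (x i)\<^sup>2)"
      using e by (subst ins[symmetric], subst sum.insert) auto
    finally show ?thesis unfolding cylinder_def mem_Collect_eq 1 T by simp
  qed
  have "emeasure lborel (cylinder e r a b) = (\<integral>\<^sup>+x. indicator (cylinder e r a b) x \<partial>lborel)"
    by simp
  also have "\<dots> = (\<integral>\<^sup>+x. indicator (cylinder e r a b) (?T x) \<partial>Pi\<^sub>M Basis (\<lambda>_. lborel))"
    by (subst lborel_eq, subst nn_integral_distr) auto
  also have "\<dots> = (\<integral>\<^sup>+x. \<integral>\<^sup>+y. indicator (cylinder e r a b) (?T (x(e := y))) \<partial>lborel \<partial>?Q)"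
    by (subst ins[symmetric], subst product_nn_integral_insert) (auto simp: ins)
  also have "\<dots> = (\<integral>\<^sup>+x. \<integral>\<^sup>+y. indicator ?D x * indicator {a..b} y \<partial>lborel \<partial>?Q)"
    by (intro nn_integral_cong) (auto simp: mem indicator_def simp del: fun_upd_apply)
  also have "\<dots> = (\<integral>\<^sup>+x. indicator ?D x * ennreal (b - a) \<partial>?Q)"
    using ab by (subst nn_integral_cmult) auto
  also have "\<dots> = emeasure ?Q ?D * ennreal (b - a)"
    by (subst nn_integral_multc) auto
  also have "emeasure ?Q ?D = ennreal (unit_ball_vol (real (card ?J)) * r ^ card ?J)"
    using r by (subst emeasure_cball_aux) auto
  also have "card ?J = DIM('a) - 1" using e by simp
  finally show ?thesis using ab r by (simp flip: ennreal_mult')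
qed

lemma emeasure_cylinder:
  fixes e :: "'a::euclidean_space"
  assumes e: "norm e = 1" and r: "r > 0" and ab: "a \<le> b"
  shows "emeasure lborel (cylinder e r a b)
    = ennreal (unit_ball_vol (real (DIM('a) - 1)) * r ^ (DIM('a) - 1) * (b - a))"
proof -
  obtain k :: 'a where k: "k \<in> Basis" by (meson nonempty_Basis ex_in_conv)
  then obtain f where f: "orthogonal_transformation f" "f k = e"
    using orthogonal_transformation_unit_vectors[of k e] e by auto
  have lin: "linear f" using f by (simp add: orthogonal_transformation_linear)
  have [measurable]: "f \<in> borel_measurable borel"
    by (intro borel_measurable_continuous_onI linear_continuous_on linear_linear[THEN iffD2] lin)
  have ip: "f x \<bullet> f y = x \<bullet> y" and nf: "norm (f x) = norm x" for x y
    using f(1) by (simp_all add: orthogonal_transformation_def norm_eq_sqrt_inner)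
  have "f x - (f x \<bullet> f k) *\<^sub>R f k = f (x - (x \<bullet> k) *\<^sub>R k)" for x
    by (simp add: linear_diff[OF lin] linear_scale[OF lin] ip)
  then have "f -` cylinder e r a b = cylinder k r a b"
    unfolding cylinder_def f(2)[symmetric] by (simp add: ip nf)
  then have "emeasure lborel (cylinder k r a b) = emeasure (distr lborel borel f) (cylinder e r a b)"
    by (subst emeasure_distr) auto
  then show ?thesis
    using emeasure_cylinder_Basis[OF k r ab] f by (simp add: lborel_distr_orthogonal_transformation)
qed

section \<open>The Hausdorff measure of the unit sphere\<close>

text \<open>The radius \<open>0\<close>, which occurs for covering pieces that meet the sphere in
  one point, is reached from larger radii by continuity. For \<open>n = 1\<close> the convention
  \<open>0 ^ 0 = 1\<close> leaves the length of the interval.\<close>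

lemma emeasure_cylinder_le:
  fixes e :: "'a::euclidean_space"
  assumes e: "norm e = 1" and r: "r \<ge> 0" and ab: "a \<le> b"
  shows "emeasure lborel (cylinder e r a b)
    \<le> ennreal (unit_ball_vol (real (DIM('a) - 1)) * r ^ (DIM('a) - 1) * (b - a))"
proof (rule tendsto_lowerbound)
  let ?F = "\<lambda>t. unit_ball_vol (real (DIM('a) - 1)) * t ^ (DIM('a) - 1) * (b - a)"
  show "((\<lambda>t. ennreal (?F t)) \<longlongrightarrow> ennreal (?F r)) (at_right r)"
    by (intro tendsto_ennrealI tendsto_intros)
  show "\<forall>\<^sub>F t in at_right r. emeasure lborel (cylinder e r a b) \<le> ennreal (?F t)"
    unfolding eventually_at_filter
  proof (intro always_eventually allI impI)
    fix t assume t: "t \<in> {r<..}"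
    then have "emeasure lborel (cylinder e r a b) \<le> emeasure lborel (cylinder e t a b)"
      by (intro emeasure_mono) (auto simp: cylinder_def)
    then show "emeasure lborel (cylinder e r a b) \<le> ennreal (?F t)"
      using emeasure_cylinder[OF e, of t a b] t r ab by simp
  qed
qed simp

lemma norm_orthogonal_part_le:
  fixes e x :: "'a::euclidean_space"
  assumes "norm e = 1"
  shows "norm (x - (x \<bullet> e) *\<^sub>R e) \<le> norm x"
proof (rule power2_le_imp_le)
  have ee: "e \<bullet> e = 1" using assms by (simp add: dot_square_norm)
  have "(norm (x - (x \<bullet> e) *\<^sub>R e))\<^sup>2 = (norm x)\<^sup>2 - (x \<bullet> e)\<^sup>2"
    unfolding power2_norm_eq_inner
    by (simp add: inner_diff_left inner_diff_right ee inner_commute power2_eq_square algebra_simps)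
  then show "(norm (x - (x \<bullet> e) *\<^sub>R e))\<^sup>2 \<le> (norm x)\<^sup>2" by simp
qed simp

text \<open>For \<open>C\<close> on the unit sphere this is the part of the cone over
  \<open>C\<close> between the radii \<open>1 - h\<close> and \<open>1\<close>. As an image under a
  continuous map it inherits compactness from \<open>C\<close>.\<close>

definition shell :: "real \<Rightarrow> 'a::euclidean_space set \<Rightarrow> 'a set" where
  "shell h C = (\<lambda>(t, x). t *\<^sub>R x) ` ({1 - h..1} \<times> C)"

lemma compact_shell: "compact C \<Longrightarrow> compact (shell h C)"
  unfolding shell_def
  by (intro compact_continuous_image compact_Times) (auto simp: case_prod_unfold intro!: continuous_intros)

text \<open>Fix a point \<open>e\<close> of \<open>C\<close>. The points of \<open>C\<close> have
  height at least \<open>1 - d\<^sup>2 / 2\<close> over the hyperplane orthogonal to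
  \<open>e\<close>, so heights in the shell range over an interval of length
  \<open>h + d\<^sup>2 / 2\<close>, while differences orthogonal to \<open>e\<close> have norm at
  most \<open>(1 + h) * d\<close>. Half differences therefore lie in a cylinder of half that width,
  which gives the factor \<open>d / 2\<close> of the Hausdorff cost.\<close>

lemma emeasure_shell_le:
  fixes C :: "'a::euclidean_space set"
  assumes C: "compact C" "C \<noteq> {}" "C \<subseteq> sphere 0 1" and h: "0 < h" "h < 1"
  defines "d \<equiv> diameter C"
  shows "emeasure lborel (shell h C) \<le>
    ennreal (unit_ball_vol (real (DIM('a) - 1)) * (d / 2) ^ (DIM('a) - 1) * ((1 + h) ^ (DIM('a) - 1) * (h + d\<^sup>2 / 2)))"
proof -
  obtain e where e: "e \<in> C" using C by auto
  have ne: "norm x = 1" if "x \<in> C" for x using C that by auto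
  have dist: "norm (x - y) \<le> d" if "x \<in> C" "y \<in> C" for x y
    using diameter_bounded_bound[OF compact_imp_bounded[OF C(1)]] that by (auto simp: d_def dist_norm)
  have d0: "d \<ge> 0" using dist[OF e e] by simp
  let ?P = "\<lambda>x. x - (x \<bullet> e) *\<^sub>R e"
  have P_le: "norm (?P x) \<le> norm x" for x by (rule norm_orthogonal_part_le) (use e ne in auto)
  define b where "b = (h + d\<^sup>2 / 2) / 2"
  have b0: "b \<ge> 0" using h by (simp add: b_def)
  have ee: "e \<bullet> e = 1" using ne[OF e] by (simp add: dot_square_norm)
  have ip: "1 - d\<^sup>2 / 2 \<le> x \<bullet> e" "x \<bullet> e \<le> 1" if "x \<in> C" for x
  proof -
    have "(norm (x - e))\<^sup>2 = 2 - 2 * (x \<bullet> e)"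
      unfolding power2_norm_eq_inner using ne[OF that, THEN norm_eq_1[THEN iffD1]]
      by (simp add: inner_diff_left inner_diff_right ee inner_commute)
    moreover have "(norm (x - e))\<^sup>2 \<le> d\<^sup>2" using dist[OF that e] by (intro power_mono) auto
    moreover have "0 \<le> (norm (x - e))\<^sup>2" by simp
    ultimately show "1 - d\<^sup>2 / 2 \<le> x \<bullet> e" "x \<bullet> e \<le> 1" by linarith+
  qed
  have comp: "1 - h - d\<^sup>2 / 2 \<le> (t *\<^sub>R x) \<bullet> e \<and> (t *\<^sub>R x) \<bullet> e \<le> 1" if "x \<in> C" "t \<in> {1-h..1}" for x t
  proof -
    have "t * (1 - x \<bullet> e) \<le> 1 * (d\<^sup>2 / 2)"
      using ip[OF that(1)] that(2) h by (intro mult_mono) auto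
    moreover have "t * (x \<bullet> e) \<le> 1 * 1"
      using ip[OF that(1)] that(2) h mult_le_one[of t "x \<bullet> e"] mult_nonneg_nonpos[of t "x \<bullet> e"]
      by (cases "x \<bullet> e \<ge> 0") auto
    ultimately show ?thesis using that by (auto simp: algebra_simps)
  qed
  have "emeasure lborel (shell h C) \<le> emeasure lborel (cylinder e ((1 + h) * d / 2) (- b) b)"
  proof (rule emeasure_le_half_difference)
    fix u v assume "u \<in> shell h C" "v \<in> shell h C"
    then obtain s t x y where u: "u = s *\<^sub>R x" and v: "v = t *\<^sub>R y" and xy: "x \<in> C" "y \<in> C"
      and st: "s \<in> {1-h..1}" "t \<in> {1-h..1}" by (auto simp: shell_def)
    let ?z = "(1/2) *\<^sub>R (u - v)"
    have "- (2 * b) \<le> u \<bullet> e - v \<bullet> e" "u \<bullet> e - v \<bullet> e \<le> 2 * b"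
      using comp[OF xy(1) st(1)] comp[OF xy(2) st(2)] unfolding u v b_def by (auto simp: field_simps)
    then have 1: "- b \<le> ?z \<bullet> e" "?z \<bullet> e \<le> b" by (simp_all add: inner_diff_left)
    \<comment> \<open>As \<open>?P e = 0\<close>, the vector \<open>?P y\<close> may be replaced by
      \<open>?P (y - e)\<close>, which is controlled by the diameter.\<close>
    have "?P (u - v) = s *\<^sub>R ?P (x - y) + (s - t) *\<^sub>R ?P (y - e)"
      unfolding u v by (simp add: algebra_simps inner_diff_left inner_add_left ee)
    also have "norm \<dots> \<le> \<bar>s\<bar> * norm (?P (x - y)) + \<bar>s - t\<bar> * norm (?P (y - e))"
      by (rule norm_triangle_le) simp
    also have "\<dots> \<le> 1 * d + h * d"
      using st h d0 dist[OF xy] dist[OF xy(2) e] P_le[of "x - y"] P_le[of "y - e"]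
      by (intro add_mono mult_mono) auto
    finally have "norm (?P (u - v)) \<le> (1 + h) * d" by (simp add: algebra_simps)
    moreover have "?P ?z = (1/2) *\<^sub>R ?P (u - v)" by (simp add: algebra_simps)
    ultimately have "norm (?P ?z) \<le> (1 + h) * d / 2" by simp
    with 1 show "?z \<in> cylinder e ((1 + h) * d / 2) (- b) b" by (simp add: cylinder_def)
  qed (use C in \<open>auto intro: compact_shell\<close>)
  also have "\<dots> \<le> ennreal (unit_ball_vol (real (DIM('a) - 1)) * ((1 + h) * d / 2) ^ (DIM('a) - 1) * (b - (- b)))"
    using d0 h ne[OF e] b0 by (intro emeasure_cylinder_le) auto
  also have "\<dots> = ennreal (unit_ball_vol (real (DIM('a) - 1)) * (d / 2) ^ (DIM('a) - 1) * ((1 + h) ^ (DIM('a) - 1) * (h + d\<^sup>2 / 2)))"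
    by (simp add: b_def power_mult_distrib power_divide mult_ac)
  finally show ?thesis .
qed

lemma emeasure_annulus:
  assumes "0 < h" "h < 1"
  shows "emeasure lborel (cball 0 1 - ball 0 (1 - h) :: 'a::euclidean_space set)
    = ennreal (unit_ball_vol (DIM('a)) * (1 - (1 - h) ^ DIM('a)))"
proof -
  have "emeasure lborel (cball 0 1 - ball 0 (1 - h) :: 'a set)
    = emeasure lborel (cball 0 1 :: 'a set) - emeasure lborel (ball 0 (1 - h) :: 'a set)"
    using assms by (intro emeasure_Diff) (auto simp: emeasure_ball)
  also have "\<dots> = ennreal (unit_ball_vol (DIM('a)) * (1 - (1 - h) ^ DIM('a)))"
    using assms by (simp add: emeasure_ball emeasure_cball ennreal_minus algebra_simps)
  finally show ?thesis .
qed

text \<open>The shells over the pieces of any admissible cover of the sphere cover the annulus, and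
  the volume of each is at most its Hausdorff cost times a common constant.\<close>

lemma annulus_le_hausdorff_pre_measure:
  assumes h: "0 < h" "h < 1" and \<delta>: "0 < \<delta>"
  shows "ennreal (unit_ball_vol (DIM('a)) * (1 - (1 - h) ^ DIM('a))) \<le>
    hausdorff_pre_measure (DIM('a) - 1) \<delta> (sphere (0::'a::euclidean_space) 1)
      * ennreal ((1 + h) ^ (DIM('a) - 1) * (h + \<delta>\<^sup>2 / 2))"
proof -
  let ?S = "sphere (0::'a) 1" and ?m = "DIM('a) - 1"
  define c where "c = (1 + h) ^ ?m * (h + \<delta>\<^sup>2 / 2)"
  have c0: "c > 0" using h by (simp add: c_def add_pos_nonneg)
  have main: "ennreal (unit_ball_vol (DIM('a)) * (1 - (1 - h) ^ DIM('a))) \<le> (\<Sum>i. hausdorff_cost ?m (C i)) * ennreal c"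
    if cov: "?S \<subseteq> (\<Union>i. C i)" and C: "\<forall>i. bounded (C i) \<and> diameter (C i) \<le> \<delta>" for C :: "nat \<Rightarrow> 'a set"
  proof -
    \<comment> \<open>Intersecting with the sphere and taking the closure yields a compact subset of
      the sphere without increasing the diameter, as the shell estimate requires.\<close>
    define K where "K i = closure (C i \<inter> ?S)" for i
    have K: "compact (K i)" "K i \<subseteq> ?S" for i
      unfolding K_def by (auto intro!: bounded_Int simp: closure_minimal)
    have dK: "diameter (K i) \<le> diameter (C i)" for i
      unfolding K_def using C
      by (subst diameter_closure) (auto intro!: diameter_subset intro: bounded_Int)
    have "emeasure lborel (shell h (K i)) \<le> hausdorff_cost ?m (C i) * ennreal c" for i
    proof (cases "K i = {}")
      case True
      then show ?thesis by (simp add: shell_def)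
    next
      case False
      then have ne: "C i \<noteq> {}" unfolding K_def by auto
      have d0: "0 \<le> diameter (K i)" using K by (simp add: compact_imp_bounded diameter_ge_0)
      have "emeasure lborel (shell h (K i)) \<le> ennreal (unit_ball_vol (real ?m) * (diameter (K i) / 2) ^ ?m *
          ((1 + h) ^ ?m * (h + (diameter (K i))\<^sup>2 / 2)))"
        by (rule emeasure_shell_le[OF K(1) False K(2) h])
      also have "\<dots> \<le> ennreal (unit_ball_vol (real ?m) * (diameter (C i) / 2) ^ ?m * c)"
        unfolding c_def using dK[of i] C[rule_format, of i] d0 h
        by (intro ennreal_leI mult_mono power_mono add_mono divide_right_mono) auto
      also have "\<dots> = hausdorff_cost ?m (C i) * ennreal c"
        using ne c0 dK[of i] d0 by (simp add: hausdorff_cost_def ennreal_mult)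
      finally show ?thesis .
    qed
    then have le: "(\<Sum>i. emeasure lborel (shell h (K i))) \<le> (\<Sum>i. hausdorff_cost ?m (C i) * ennreal c)"
      by (intro suminf_le) auto
    have sub: "cball 0 1 - ball 0 (1 - h) \<subseteq> (\<Union>i. shell h (K i))"
    proof
      fix x :: 'a assume x: "x \<in> cball 0 1 - ball 0 (1 - h)"
      then have nx: "norm x \<in> {1-h..1}" "norm x > 0" using h by auto
      then have "(1 / norm x) *\<^sub>R x \<in> ?S" by simp
      then obtain i where i: "(1 / norm x) *\<^sub>R x \<in> C i \<inter> ?S" using cov by blast
      then have "(1 / norm x) *\<^sub>R x \<in> K i" unfolding K_def by (rule closure_subset[THEN subsetD])
      then have "norm x *\<^sub>R (1 / norm x) *\<^sub>R x \<in> shell h (K i)" 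
        unfolding shell_def using nx
        by (intro image_eqI[where x="(norm x, (1 / norm x) *\<^sub>R x)"]) auto
      then show "x \<in> (\<Union>i. shell h (K i))" using nx by auto
    qed
    have "ennreal (unit_ball_vol (DIM('a)) * (1 - (1 - h) ^ DIM('a))) = emeasure lborel (cball 0 1 - ball 0 (1 - h) :: 'a set)"
      using emeasure_annulus[OF h, where 'a='a] by simp
    also have "\<dots> \<le> emeasure lborel (\<Union>i. shell h (K i))"
      using sub by (intro emeasure_mono sets.countable_UN) (auto intro: borel_compact compact_shell K)
    also have "\<dots> \<le> (\<Sum>i. emeasure lborel (shell h (K i)))"
      using K by (intro emeasure_subadditive_countably) (auto intro: borel_compact compact_shell)
    also note le
    also have "(\<Sum>i. hausdorff_cost ?m (C i) * ennreal c) = (\<Sum>i. hausdorff_cost ?m (C i)) * ennreal c"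
      by (rule ennreal_suminf_multc)
    finally show ?thesis .
  qed
  have "ennreal (unit_ball_vol (DIM('a)) * (1 - (1 - h) ^ DIM('a))) / ennreal c \<le> hausdorff_pre_measure ?m \<delta> ?S"
    unfolding hausdorff_pre_measure_def
  proof (rule INF_greatest, clarify)
    fix C :: "nat \<Rightarrow> 'a set"
    assume "?S \<subseteq> (\<Union>i. C i)" "\<forall>i. bounded (C i) \<and> diameter (C i) \<le> \<delta>"
    from main[OF this] have "ennreal (unit_ball_vol (DIM('a)) * (1 - (1 - h) ^ DIM('a))) / ennreal c
      \<le> (\<Sum>i. hausdorff_cost ?m (C i)) * ennreal c / ennreal c"
      by (rule divide_right_mono_ennreal)
    then show "ennreal (unit_ball_vol (DIM('a)) * (1 - (1 - h) ^ DIM('a))) / ennreal c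
      \<le> (\<Sum>i. hausdorff_cost ?m (C i))"
      using c0 by (simp add: ennreal_mult_divide_eq)
  qed
  then have "ennreal (unit_ball_vol (DIM('a)) * (1 - (1 - h) ^ DIM('a))) / ennreal c * ennreal c
    \<le> hausdorff_pre_measure ?m \<delta> ?S * ennreal c" by (rule mult_right_mono) simp
  moreover have "x / ennreal c * ennreal c = x" for x
    using c0 by (simp add: ennreal_divide_times ennreal_mult_divide_eq)
  ultimately show ?thesis by (simp add: c_def)
qed


section \<open>Upper bound for the Hausdorff measure of the sphere\<close>

text \<open>The height bound \<open>1 - r\<^sup>2\<close> keeps the cylinder inside the unit ball.
  The radius \<open>r * (1 - h)\<close> at heights of at least \<open>1 - h\<close> bounds the
  tangent of the angle between \<open>x\<close> and \<open>a\<close> by \<open>r\<close>, so the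
  radial projection stays within \<open>r\<close> of \<open>a\<close>.\<close>

lemma cylinder_subset_shell:
  fixes a :: "'a::euclidean_space"
  assumes a: "norm a = 1" and h: "0 < h" "h < 1" and r: "0 < r" "r < 1"
    and x: "x \<in> cylinder a (r * (1 - h)) (1 - h) (1 - r\<^sup>2)"
  shows "x \<in> cball 0 1 - ball 0 (1 - h)" "(1 / norm x) *\<^sub>R x \<in> cball a r"
proof -
  define \<tau> where "\<tau> = x \<bullet> a"
  define u where "u = x - \<tau> *\<^sub>R a"
  have \<tau>: "1 - h \<le> \<tau>" "\<tau> \<le> 1 - r\<^sup>2" and u: "norm u \<le> r * (1 - h)"
    using x by (auto simp: cylinder_def \<tau>_def u_def)
  have \<tau>0: "0 < \<tau>" using \<tau> h by simp
  have aa: "a \<bullet> a = 1" using a by (simp add: dot_square_norm)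
  have ua: "u \<bullet> a = 0" by (simp add: u_def \<tau>_def inner_diff_left aa)
  have xu: "x = u + \<tau> *\<^sub>R a" by (simp add: u_def)
  have nx: "(norm x)\<^sup>2 = (norm u)\<^sup>2 + \<tau>\<^sup>2"
    unfolding power2_norm_eq_inner xu
    by (simp add: inner_add_left inner_add_right ua inner_commute[of a u] aa power2_eq_square)
  have u2: "(norm u)\<^sup>2 \<le> r\<^sup>2 * (1 - h)\<^sup>2"
    using power_mono[OF u norm_ge_zero, of 2] by (simp add: power_mult_distrib)
  have ur: "(norm u)\<^sup>2 \<le> r\<^sup>2"
  proof -
    have "r\<^sup>2 * (1 - h)\<^sup>2 \<le> r\<^sup>2 * 1" using h by (intro mult_left_mono power_le_one) auto
    with u2 show ?thesis by simp
  qed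
  have \<tau>x: "\<tau> \<le> norm x" by (rule power2_le_imp_le) (use nx in auto)
  then have nx0: "0 < norm x" using \<tau>0 by linarith
  have r21: "r\<^sup>2 \<le> 1" using r by (intro power_le_one) auto
  have "\<tau> \<le> 1" using \<tau>(2) zero_le_power2[of r] by linarith
  then have "\<tau>\<^sup>2 \<le> \<tau>" using \<tau>0 by (simp add: power2_eq_square mult_left_le_one_le)
  then have "(norm x)\<^sup>2 \<le> 1\<^sup>2" using nx ur \<tau> by simp
  then have "norm x \<le> 1" by (rule power2_le_imp_le) simp
  then show "x \<in> cball 0 1 - ball 0 (1 - h)" using \<tau>x \<tau> by auto
  define c where "c = \<tau> / norm x"
  have c: "0 < c" "c \<le> 1" using \<tau>0 nx0 \<tau>x by (auto simp: c_def)
  define y where "y = (1 / norm x) *\<^sub>R x"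
  have "norm y = 1" using nx0 by (simp add: y_def)
  then have yy: "y \<bullet> y = 1" by (simp add: dot_square_norm)
  have ya: "y \<bullet> a = c" by (simp add: y_def c_def \<tau>_def)
  have "(norm (y - a))\<^sup>2 = 2 - 2 * c"
    unfolding power2_norm_eq_inner
    by (simp add: inner_diff_left inner_diff_right inner_commute[of a y] aa yy ya)
  \<comment> \<open>With \<open>c\<close> the cosine of the angle between \<open>x\<close> and
    \<open>a\<close>, this says that the chord is at most the tangent.\<close>
  also have "\<dots> \<le> (1 - c\<^sup>2) / c\<^sup>2"
  proof -
    have "(1 - c) * (2 * c\<^sup>2) \<le> (1 - c) * (1 + c)"
    proof (rule mult_left_mono)
      have "c\<^sup>2 \<le> c" using c by (simp add: power2_eq_square mult_left_le_one_le)
      then show "2 * c\<^sup>2 \<le> 1 + c" using c by simp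
    qed (use c in simp)
    then have "(2 - 2 * c) * c\<^sup>2 \<le> 1 - c\<^sup>2" by (simp add: algebra_simps power2_eq_square)
    then show ?thesis using c by (simp add: pos_le_divide_eq)
  qed
  also have "(1 - c\<^sup>2) / c\<^sup>2 = (norm u)\<^sup>2 / \<tau>\<^sup>2"
    using nx nx0 \<tau>0 by (simp add: c_def power_divide divide_simps)
  also have "\<dots> \<le> (norm u)\<^sup>2 / (1 - h)\<^sup>2"
    using \<tau> h \<tau>0 by (intro divide_left_mono power_mono mult_pos_pos) auto
  also have "\<dots> \<le> r\<^sup>2" using u2 h by (simp add: pos_divide_le_eq)
  finally have "norm (y - a) \<le> r" by (rule power2_le_imp_le) (use r in simp)
  then show "(1 / norm x) *\<^sub>R x \<in> cball a r" by (simp add: y_def dist_norm norm_minus_commute)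
qed

lemma diameter_subset_cball_le:
  fixes C :: "'a::euclidean_space set"
  assumes "C \<subseteq> cball x r" "0 \<le> r"
  shows "bounded C" "diameter C \<le> 2 * r"
proof -
  show b: "bounded C" using assms bounded_subset bounded_cball by blast
  have "diameter C \<le> diameter (cball x r)" using assms by (intro diameter_subset) auto
  then show "diameter C \<le> 2 * r" using assms by simp
qed

lemma hausdorff_cost_le_cball:
  fixes C :: "'a::euclidean_space set"
  assumes "C \<subseteq> cball x r" "0 \<le> r"
  shows "hausdorff_cost d C \<le> ennreal (unit_ball_vol (real d) * r ^ d)"
  unfolding hausdorff_cost_def
  using diameter_subset_cball_le[OF assms] diameter_ge_0[of C]
  by (auto intro!: ennreal_leI mult_left_mono power_mono)

text \<open>A Vitali family of disjoint balls of radius at most \<open>h\<close> centred on the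
  sphere has bounded total cost, because the disjoint cylinders belonging to the balls fit into the
  annulus. Fivefold enlargements have diameter at most \<open>10 * h\<close> and need to be used
  only for a remainder of the family, whose cost is arbitrarily small.\<close>

lemma hausdorff_pre_measure_sphere_le:
  assumes h: "0 < h" "h < 1"
  shows "hausdorff_pre_measure (DIM('a) - 1) (10 * h) (sphere (0::'a::euclidean_space) 1)
    \<le> ennreal (unit_ball_vol (DIM('a)) * (1 - (1 - h) ^ DIM('a)) / (h * (1 - h) ^ DIM('a)))"
proof -
  let ?S = "sphere (0::'a) 1" and ?m = "DIM('a) - 1"
  define w where "w = unit_ball_vol (real ?m)"
  have w: "w > 0" by (simp add: w_def)
  define U where "U = unit_ball_vol (DIM('a)) * (1 - (1 - h) ^ DIM('a)) / (h * (1 - h) ^ DIM('a))"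
  obtain C :: "('a \<times> real) set" where C: "countable C" "C \<subseteq> ?S \<times> {0<..h}"
    and disj: "pairwise (\<lambda>i j. disjnt (cball (fst i) (snd i)) (cball (fst j) (snd j))) C"
    and cov: "\<And>i. i \<in> ?S \<times> {0<..h} \<Longrightarrow> \<exists>j. j \<in> C \<and> \<not> disjnt (cball (fst i) (snd i)) (cball (fst j) (snd j)) \<and>
                        cball (fst i) (snd i) \<subseteq> ball (fst j) (5 * snd j)"
    using Vitali_covering_lemma_cballs_balls[of "?S \<times> {0<..h}" snd h fst] by (auto simp: mem_Times_iff)
  \<comment> \<open>The family \<open>C\<close> may be finite, so its members are numbered by a set
    \<open>I\<close> of natural numbers; the other indices carry cost zero and empty sets.\<close>
  define I where "I = to_nat_on C ` C"
  define a where "a n = fst (from_nat_into C n)" for n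
  define r where "r n = snd (from_nat_into C n)" for n
  have ar: "norm (a n) = 1" "0 < r n" "r n \<le> h" if "n \<in> I" for n
    using that C by (auto simp: I_def a_def r_def)
  have dj: "cball (a i) (r i) \<inter> cball (a j) (r j) = {}" if "i \<in> I" "j \<in> I" "i \<noteq> j" for i j
    using that disj C(1) unfolding I_def a_def r_def pairwise_def disjnt_def by fastforce
  have cv: "\<exists>n\<in>I. cball x s \<inter> cball (a n) (r n) \<noteq> {} \<and> cball x s \<subseteq> ball (a n) (5 * r n)"
    if "x \<in> ?S" "0 < s" "s \<le> h" for x s
    using cov[of "(x, s)"] that C(1) unfolding I_def a_def r_def disjnt_def by fastforce
  define c where "c n = (if n \<in> I then w * r n ^ ?m else 0)" for n
  have c0: "0 \<le> c n" for n using ar[of n] w by (auto simp: c_def)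
  \<comment> \<open>The factor between the cost of a ball and the volume of its cylinder:
    \<open>(1 - h) ^ ?m\<close> comes from the reduced radius, and \<open>h - h\<^sup>2\<close> is a
    lower bound for the length \<open>h - (r n)\<^sup>2\<close> of the cylinder.\<close>
  define k where "k = (1 - h) ^ ?m * (h - h\<^sup>2)"
  have "h\<^sup>2 < h" using h by (simp add: power2_eq_square)
  then have k0: "k > 0" using h by (simp add: k_def)
  define Z where "Z n = (if n \<in> I then cylinder (a n) (r n * (1 - h)) (1 - h) (1 - (r n)\<^sup>2) else {})" for n
  have Zsub: "x \<in> cball 0 1 - ball 0 (1 - h)" "(1 / norm x) *\<^sub>R x \<in> cball (a n) (r n)" "n \<in> I" 
    if "x \<in> Z n" for x n
    using cylinder_subset_shell[of "a n" h "r n" x] that ar[of n] h by (auto simp: Z_def split: if_splits)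
  have Zm: "Z n \<in> sets borel" for n by (auto simp: Z_def)
  \<comment> \<open>A point common to two of the cylinders would project radially into two of the
    disjoint balls.\<close>
  have "disjoint_family Z"
    unfolding disjoint_family_on_def using Zsub dj by blast
  then have "(\<Sum>n. emeasure lborel (Z n)) = emeasure lborel (\<Union>n. Z n)"
    using Zm by (intro suminf_emeasure) auto
  also have "\<dots> \<le> emeasure lborel (cball 0 1 - ball 0 (1 - h) :: 'a set)"
    using Zsub(1) by (intro emeasure_mono) auto
  also have "\<dots> = ennreal (unit_ball_vol (DIM('a)) * (1 - (1 - h) ^ DIM('a)))"
    by (rule emeasure_annulus[OF h])
  finally have sumZ: "(\<Sum>n. emeasure lborel (Z n)) \<le> ennreal (unit_ball_vol (DIM('a)) * (1 - (1 - h) ^ DIM('a)))" .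
  have "ennreal (c n * k) \<le> emeasure lborel (Z n)" for n
  proof (cases "n \<in> I")
    case True
    have r2: "(r n)\<^sup>2 \<le> h\<^sup>2" using ar[OF True] by (intro power_mono) auto
    have "emeasure lborel (Z n) = ennreal (w * (r n * (1 - h)) ^ ?m * (1 - (r n)\<^sup>2 - (1 - h)))"
      using emeasure_cylinder[OF ar(1)[OF True], of "r n * (1 - h)" "1 - h" "1 - (r n)\<^sup>2"]
        True ar(2)[OF True] h r2 \<open>h\<^sup>2 < h\<close> unfolding Z_def w_def by auto
    moreover have "c n * k \<le> w * (r n * (1 - h)) ^ ?m * (1 - (r n)\<^sup>2 - (1 - h))"
      using True ar[OF True] h w r2
      by (auto simp: c_def k_def power_mult_distrib mult.assoc intro!: mult_left_mono)
    ultimately show ?thesis by (simp add: ennreal_leI)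
  qed (simp add: c_def)
  then have "(\<Sum>n. ennreal (c n * k)) \<le> (\<Sum>n. emeasure lborel (Z n))"
    by (intro suminf_le) auto
  also note sumZ
  also have "unit_ball_vol (DIM('a)) * (1 - (1 - h) ^ DIM('a)) = U * k"
  proof -
    have eq: "(1 - h) ^ DIM('a) = (1 - h) ^ ?m * (1 - h)"
      by (metis DIM_positive Suc_pred' power_Suc2 mult.commute)
    have "h - h\<^sup>2 = h * (1 - h)" by (simp add: power2_eq_square algebra_simps)
    then have "k = h * (1 - h) ^ DIM('a)" by (simp only: k_def eq mult_ac)
    then show ?thesis using k0 h by (simp add: U_def)
  qed
  finally have sumck: "(\<Sum>n. ennreal (c n * k)) \<le> ennreal (U * k)" .
  have U0: "U \<ge> 0" using h by (auto simp: U_def power_le_one intro!: divide_nonneg_nonneg mult_nonneg_nonneg)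
  have summ: "summable c"
  proof -
    have "(\<Sum>n. ennreal (c n * k)) \<noteq> top" using sumck by (auto simp: top_unique)
    then have "summable (\<lambda>n. c n * k)" using c0 k0 by (intro summable_suminf_not_top) auto
    then show ?thesis using k0 by (simp add: summable_cmult_iff mult.commute[of _ k])
  qed
  have sumc: "(\<Sum>n. ennreal (c n)) \<le> ennreal U"
  proof -
    have "ennreal ((\<Sum>n. c n) * k) = (\<Sum>n. ennreal (c n * k))"
      using summ c0 k0 by (subst suminf_mult2) (auto intro!: suminf_ennreal2[symmetric] summable_mult2)
    also note sumck
    finally have "(\<Sum>n. c n) * k \<le> U * k"
      by (rule ennreal_le_iff[THEN iffD1, rotated]) (use U0 k0 in simp)
    then show ?thesis using k0 c0 summ by (simp add: suminf_ennreal2 ennreal_leI)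
  qed
  have main: "hausdorff_pre_measure ?m (10 * h) ?S \<le> ennreal U + ennreal (5 ^ ?m * (\<Sum>n. c (n + M)))" for M
  proof -
    \<comment> \<open>The first \<open>M\<close> caps need no enlargement: a point outside them has a small ball missing
      them all, hence lies in the enlargement of a later cap.\<close>
    define D where "D n = (if n \<in> I then (if n < M then cball (a n) (r n) else cball (a n) (5 * r n)) else {})" for n
    have "?S \<subseteq> (\<Union>n. D n)"
    proof
      fix x assume x: "x \<in> ?S"
      show "x \<in> (\<Union>n. D n)"
      proof (rule ccontr)
        assume nx: "x \<notin> (\<Union>n. D n)"
        define F where "F = (\<Union>n\<in>I \<inter> {..<M}. cball (a n) (r n))"
        have "closed F" by (auto simp: F_def intro!: closed_UN)
        moreover have "x \<notin> F" using nx by (force simp: F_def D_def)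
        ultimately obtain s0 where s0: "s0 > 0" "cball x s0 \<subseteq> - F"
          using open_contains_cball[of "- F"] by auto
        define s where "s = min s0 h"
        have s: "0 < s" "s \<le> h" "cball x s \<subseteq> - F" using s0 h by (auto simp: s_def)
        then obtain n where n: "n \<in> I" "cball x s \<inter> cball (a n) (r n) \<noteq> {}" "cball x s \<subseteq> ball (a n) (5 * r n)"
          using cv[OF x] by blast
        have "\<not> n < M" using n(1,2) s(3) by (auto simp: F_def)
        moreover have "x \<in> cball x s" using s(1) by simp
        then have "x \<in> cball (a n) (5 * r n)" using n(3) ball_subset_cball by blast
        ultimately have "x \<in> D n" using n(1) by (simp add: D_def)
        then show False using nx by blast
      qed
    qed
    moreover have "bounded (D n)" "diameter (D n) \<le> 10 * h" for n
      using h ar[of n] by (auto simp: D_def)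
    ultimately have "hausdorff_pre_measure ?m (10 * h) ?S \<le> (\<Sum>n. hausdorff_cost ?m (D n))"
      unfolding hausdorff_pre_measure_def by (intro INF_lower) auto
    also have "\<dots> \<le> (\<Sum>n. ennreal (c n) + ennreal (if n < M then 0 else 5 ^ ?m * c n))"
    proof (rule suminf_le)
      fix n
      show "hausdorff_cost ?m (D n) \<le> ennreal (c n) + ennreal (if n < M then 0 else 5 ^ ?m * c n)"
      proof (cases "n \<in> I")
        case False
        then show ?thesis by (simp add: D_def hausdorff_cost_def)
      next
        case True
        show ?thesis
        proof (cases "n < M")
          case True
          then show ?thesis
            using hausdorff_cost_le_cball[of "D n" "a n" "r n" ?m] \<open>n \<in> I\<close> ar[of n] by (simp add: c_def D_def w_def)
        next
          case False
          have "hausdorff_cost ?m (D n) \<le> ennreal (5 ^ ?m * c n)"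
            using hausdorff_cost_le_cball[of "D n" "a n" "5 * r n" ?m] \<open>n \<in> I\<close> False ar[of n]
            by (simp add: c_def D_def w_def power_mult_distrib mult_ac)
          then show ?thesis using False by (simp add: add_increasing)
        qed
      qed
    qed auto
    also have "\<dots> = (\<Sum>n. ennreal (c n)) + (\<Sum>n. ennreal (if n < M then 0 else 5 ^ ?m * c n))"
      by (rule suminf_add[symmetric]) auto
    also have "(\<Sum>n. ennreal (if n < M then 0 else 5 ^ ?m * c n)) = ennreal (5 ^ ?m * (\<Sum>n. c (n + M)))"
    proof -
      have sM: "summable (\<lambda>n. c (n + M))" using summ by (simp add: summable_iff_shift)
      have "(\<Sum>n. ennreal (if n < M then 0 else 5 ^ ?m * c n)) = (\<Sum>n. ennreal (5 ^ ?m * c (n + M)))"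
        by (subst suminf_offset[where i=M]) auto
      also have "\<dots> = ennreal (\<Sum>n. 5 ^ ?m * c (n + M))"
        using sM c0 by (intro suminf_ennreal2 summable_mult) auto
      finally show ?thesis using sM by (simp add: suminf_mult)
    qed
    also note add_right_mono[OF sumc]
    finally show ?thesis by simp
  qed
  \<comment> \<open>The remainders of the convergent series of costs tend to zero, so the cost of
    enlarging disappears as \<open>M\<close> grows.\<close>
  have "(\<lambda>M. ennreal U + ennreal (5 ^ ?m * (\<Sum>n. c (n + M)))) \<longlonglongrightarrow> ennreal U + ennreal (5 ^ ?m * 0)"
    by (intro tendsto_intros tendsto_ennrealI suminf_exist_split2 summ)
  then have "hausdorff_pre_measure ?m (10 * h) ?S \<le> ennreal U + ennreal (5 ^ ?m * 0)"
    by (rule tendsto_lowerbound) (rule always_eventually allI main trivial_limit_sequentially)+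
  then show ?thesis by (simp add: U_def)
qed

section \<open>The exact Hausdorff measure of the sphere\<close>

lemma hausdorff_pre_measure_antimono:
  "\<delta> \<le> \<delta>' \<Longrightarrow> hausdorff_pre_measure d \<delta>' A \<le> hausdorff_pre_measure d \<delta> A"
  unfolding hausdorff_pre_measure_def by (rule INF_superset_mono) (auto intro: order.trans)

lemma one_minus_power_quotient_tendsto:
  "((\<lambda>h::real. (1 - (1 - h) ^ n) / h) \<longlongrightarrow> real n) (at_right 0)"
proof -
  have "((\<lambda>h::real. 1 - (1 - h) ^ n) has_real_derivative real n) (at 0)"
    by (auto intro!: derivative_eq_intros)
  then have "((\<lambda>h::real. (1 - (1 - h) ^ n) / h) \<longlongrightarrow> real n) (at 0)"
    by (simp add: DERIV_def)
  then show ?thesis by (rule tendsto_mono[rotated]) (simp add: at_le)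
qed

text \<open>Divided by \<open>h\<close>, the volume of the annulus tends to
  \<open>n \<omega>\<close> as \<open>h\<close> tends to \<open>0\<close>. For the upper bound
  \<open>h < \<delta> / 10\<close> makes the covers admissible at scale
  \<open>\<delta>\<close>.\<close>

theorem hausdorff_measure_sphere:
  "hausdorff_measure (DIM('a) - 1) (sphere (0::'a::euclidean_space) 1)
    = ennreal (real DIM('a) * unit_ball_vol (DIM('a)))"
proof (rule antisym)
  let ?S = "sphere (0::'a) 1" and ?m = "DIM('a) - 1" and ?\<omega> = "unit_ball_vol (real DIM('a))"
  let ?q = "\<lambda>h. (1 - (1 - h) ^ DIM('a)) / h"
  have ev: "\<forall>\<^sub>F h in at_right 0. 0 < h \<and> h < b" if "0 < b" for b :: real
    using that by (auto simp: eventually_at_right_field)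
  have id: "((\<lambda>h. h) \<longlongrightarrow> (0::real)) (at_right 0)" by (rule tendsto_ident_at)
  show "hausdorff_measure ?m ?S \<le> ennreal (real DIM('a) * ?\<omega>)"
    unfolding hausdorff_measure_def
  proof (rule SUP_least)
    fix \<delta> :: real assume "\<delta> \<in> {0<..}"
    then have min_pos: "0 < min 1 (\<delta> / 10)" by simp
    have "((\<lambda>h. ennreal (?\<omega> * ?q h / (1 - h) ^ DIM('a))) \<longlongrightarrow> ennreal (?\<omega> * real DIM('a) / (1 - 0) ^ DIM('a))) (at_right 0)"
      by (intro tendsto_ennrealI tendsto_intros one_minus_power_quotient_tendsto id) auto
    moreover have "\<forall>\<^sub>F h in at_right 0. hausdorff_pre_measure ?m \<delta> ?S \<le> ennreal (?\<omega> * ?q h / (1 - h) ^ DIM('a))"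
      using ev[OF min_pos]
    proof eventually_elim
      case (elim h)
      have "hausdorff_pre_measure ?m \<delta> ?S \<le> hausdorff_pre_measure ?m (10 * h) ?S"
        using elim by (intro hausdorff_pre_measure_antimono) auto
      also have "\<dots> \<le> ennreal (?\<omega> * (1 - (1 - h) ^ DIM('a)) / (h * (1 - h) ^ DIM('a)))"
        using elim by (intro hausdorff_pre_measure_sphere_le) auto
      finally show ?case by simp
    qed
    ultimately have "hausdorff_pre_measure ?m \<delta> ?S \<le> ennreal (?\<omega> * real DIM('a) / (1 - 0) ^ DIM('a))"
      by (rule tendsto_lowerbound) simp
    then show "hausdorff_pre_measure ?m \<delta> ?S \<le> ennreal (real DIM('a) * ?\<omega>)" by (simp add: mult.commute)
  qed
  then obtain H where H: "hausdorff_measure ?m ?S = ennreal H" "H \<ge> 0"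
    by (cases "hausdorff_measure ?m ?S") (auto simp: top_unique)
  have "\<forall>\<^sub>F h in at_right 0. ?\<omega> * ?q h \<le> H * ((1 + h) ^ ?m * (1 + h / 2))"
    using ev[OF zero_less_one]
  proof eventually_elim
    case (elim h)
    \<comment> \<open>The scale of the covers is taken to be \<open>h\<close> itself, so that the
      error \<open>h\<^sup>2 / 2\<close> is negligible against the thickness
      \<open>h\<close>.\<close>
    have "ennreal (?\<omega> * (1 - (1 - h) ^ DIM('a))) \<le> hausdorff_pre_measure ?m h ?S * ennreal ((1 + h) ^ ?m * (h + h\<^sup>2 / 2))"
      using elim by (intro annulus_le_hausdorff_pre_measure) auto
    also have "\<dots> \<le> hausdorff_measure ?m ?S * ennreal ((1 + h) ^ ?m * (h + h\<^sup>2 / 2))"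
      unfolding hausdorff_measure_def using elim by (intro mult_right_mono SUP_upper) auto
    also have "\<dots> = ennreal (H * ((1 + h) ^ ?m * (h + h\<^sup>2 / 2)))"
      using H elim by (simp add: ennreal_mult')
    finally have "?\<omega> * (1 - (1 - h) ^ DIM('a)) \<le> H * ((1 + h) ^ ?m * (h + h\<^sup>2 / 2))"
      using elim H by (subst (asm) ennreal_le_iff) auto
    also have "\<dots> = H * ((1 + h) ^ ?m * (1 + h / 2)) * h" by (simp add: power2_eq_square algebra_simps)
    finally show ?case using elim by (simp add: pos_divide_le_eq)
  qed
  moreover have "((\<lambda>h. ?\<omega> * ?q h) \<longlongrightarrow> ?\<omega> * real DIM('a)) (at_right 0)"
    by (intro tendsto_intros one_minus_power_quotient_tendsto)
  moreover have "((\<lambda>h. H * ((1 + h) ^ ?m * (1 + h / 2))) \<longlongrightarrow> H * ((1 + 0) ^ ?m * (1 + 0 / 2))) (at_right 0)"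
    by (intro tendsto_intros id) auto
  ultimately have "?\<omega> * real DIM('a) \<le> H * ((1 + 0) ^ ?m * (1 + 0 / 2))"
    by (intro tendsto_le[of "at_right (0::real)"]) auto
  then show "ennreal (real DIM('a) * ?\<omega>) \<le> hausdorff_measure ?m ?S"
    unfolding H(1) by (intro ennreal_leI) (simp add: mult.commute)
qed

corollary sphere_measure_eq: "sphere_measure TYPE('a::euclidean_space) = real DIM('a) * unit_ball_vol (DIM('a))"
  unfolding sphere_measure_def hausdorff_measure_sphere by simp

section \<open>The limit of the fractional perimeter\<close>

definition riesz_kernel :: "real \<Rightarrow> 'a::euclidean_space \<Rightarrow> real" where
  "riesz_kernel s z = 1 / norm z powr (real DIM('a) + s)"

lemma riesz_kernel_nonneg [simp]: "0 \<le> riesz_kernel s z"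
  by (simp add: riesz_kernel_def)

lemma riesz_kernel_measurable [measurable]: "riesz_kernel s \<in> borel_measurable borel"
  unfolding riesz_kernel_def by measurable

lemma riesz_kernel_commute: "riesz_kernel s (x - y) = riesz_kernel s (y - x)"
  by (simp add: riesz_kernel_def norm_minus_commute)

text \<open>The radius is a parameter because the kernels can be compared only far away from
  \<Omega>; the radius \<open>1\<close> corresponds to \<open>weighted_tail\<close>, up to the
  factor \<open>s\<close>.\<close>

definition tail :: "real \<Rightarrow> real \<Rightarrow> 'a::euclidean_space set \<Rightarrow> ennreal" where
  "tail \<rho> s F = (\<integral>\<^sup>+y\<in>F \<inter> - ball 0 \<rho>. ennreal (riesz_kernel s y) \<partial>lborel)"

text \<open>Completing a measure does not change nonnegative integrals, so all further integrals can
  be taken with respect to \<open>lborel\<close>.\<close>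

lemma interaction_altdef:
  "interaction s A B = (\<integral>\<^sup>+x\<in>A. (\<integral>\<^sup>+y\<in>B. ennreal (riesz_kernel s (x - y)) \<partial>lborel) \<partial>lborel)"
  unfolding interaction_def riesz_kernel_def nn_integral_completion ..

lemma interaction_commute:
  assumes [measurable]: "A \<in> sets borel" "B \<in> sets borel"
  shows "interaction s A B = interaction s B (A :: 'a::euclidean_space set)"
proof -
  have "interaction s A B = (\<integral>\<^sup>+x. \<integral>\<^sup>+y. ennreal (riesz_kernel s (x - y)) * indicator B y * indicator A x \<partial>lborel \<partial>lborel)"
    unfolding interaction_altdef by (intro nn_integral_cong nn_integral_multc[symmetric]) measurable
  also have "\<dots> = (\<integral>\<^sup>+y. \<integral>\<^sup>+x. ennreal (riesz_kernel s (x - y)) * indicator B y * indicator A x \<partial>lborel \<partial>lborel)"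
    by (rule lborel_pair.Fubini') measurable
  also have "\<dots> = (\<integral>\<^sup>+y. \<integral>\<^sup>+x. ennreal (riesz_kernel s (y - x)) * indicator A x * indicator B y \<partial>lborel \<partial>lborel)"
    by (simp add: riesz_kernel_commute mult_ac)
  also have "\<dots> = interaction s B A"
    unfolding interaction_altdef by (intro nn_integral_cong nn_integral_multc) measurable
  finally show ?thesis .
qed

text \<open>By the triangle inequality the distance of \<open>x\<close> and \<open>y\<close> lies
  between \<open>1 - q\<close> and \<open>1 + q\<close> times \<open>norm y\<close>. The exponent
  \<open>n + s\<close> of these factors is relaxed to \<open>n + 1\<close>, which makes the
  constants independent of \<open>s\<close>.\<close>

lemma riesz_kernel_far_le:
  fixes x y :: "'a::euclidean_space"
  assumes q: "0 < q" "q < 1" and x: "norm x \<le> q * norm y" and y: "y \<noteq> 0" and s: "0 < s" "s < 1"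
  shows "riesz_kernel s (x - y) \<le> riesz_kernel s y / (1 - q) ^ (DIM('a) + 1)"
    and "riesz_kernel s y / (1 + q) ^ (DIM('a) + 1) \<le> riesz_kernel s (x - y)"
proof -
  let ?p = "real DIM('a) + s" and ?N = "DIM('a) + 1"
  have y0: "norm y > 0" using y by simp
  have lo: "(1 - q) * norm y \<le> norm (x - y)"
    using norm_triangle_ineq3[of x y] x by (simp add: algebra_simps)
  have hi: "norm (x - y) \<le> (1 + q) * norm y"
    using norm_triangle_ineq4[of x y] x by (simp add: algebra_simps)
  have lo0: "0 < (1 - q) * norm y" using q y0 by simp
  have "riesz_kernel s (x - y) \<le> 1 / ((1 - q) * norm y) powr ?p"
    unfolding riesz_kernel_def using lo lo0 s
    by (intro divide_left_mono powr_mono2 mult_pos_pos) (auto simp: powr_gt_zero)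
  also have "\<dots> = riesz_kernel s y / (1 - q) powr ?p"
    using q y0 by (simp add: riesz_kernel_def powr_mult)
  also have "\<dots> \<le> riesz_kernel s y / (1 - q) ^ ?N"
  proof (rule divide_left_mono)
    have "(1 - q) powr real ?N \<le> (1 - q) powr ?p" using q s by (intro powr_mono') auto
    then show "(1 - q) ^ ?N \<le> (1 - q) powr ?p" using q by (simp only: powr_realpow)
  qed (use q in auto)
  finally show "riesz_kernel s (x - y) \<le> riesz_kernel s y / (1 - q) ^ ?N" .
  have "riesz_kernel s y / (1 + q) ^ ?N \<le> riesz_kernel s y / (1 + q) powr ?p"
  proof (rule divide_left_mono)
    have "(1 + q) powr ?p \<le> (1 + q) powr real ?N" using q s by (intro powr_mono) auto
    then show "(1 + q) powr ?p \<le> (1 + q) ^ ?N" using q by (subst (asm) powr_realpow) auto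
  qed (use q in auto)
  also have "\<dots> = 1 / ((1 + q) * norm y) powr ?p"
    using q y0 by (simp add: riesz_kernel_def powr_mult)
  also have "\<dots> \<le> riesz_kernel s (x - y)"
  proof -
    have "0 < norm (x - y)" using lo lo0 by linarith
    moreover have "0 < (1 + q) * norm y" using q y0 by simp
    ultimately show ?thesis unfolding riesz_kernel_def using hi s
      by (intro divide_left_mono powr_mono2 mult_pos_pos) auto
  qed
  finally show "riesz_kernel s y / (1 + q) ^ ?N \<le> riesz_kernel s (x - y)" .
qed

text \<open>Away from the origin the quotient of the two kernels is
  \<open>norm z powr (s0 - s)\<close>, whose exponent lies between 0 and 1. At the origin both
  kernels are zero by the convention for division.\<close>

lemma riesz_kernel_near_le:
  fixes z :: "'a::euclidean_space"
  assumes R: "1 \<le> R" "norm z \<le> R" and s: "0 < s" "s \<le> s0" "s0 < 1"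
  shows "riesz_kernel s z \<le> R * riesz_kernel s0 z"
proof (cases "z = 0")
  case False
  have "riesz_kernel s z = norm z powr (s0 - s) * riesz_kernel s0 z"
    using False by (simp add: riesz_kernel_def powr_add[symmetric] powr_diff[symmetric] divide_simps)
  moreover have "norm z powr (s0 - s) \<le> R powr (s0 - s)" using R s by (intro powr_mono2) auto
  moreover have "R powr (s0 - s) \<le> R powr 1" using R s by (intro powr_mono) auto
  ultimately show ?thesis using R by (simp add: mult_right_mono)
qed (simp add: riesz_kernel_def)

text \<open>The set \<open>B\<close> is split at the radius \<open>M / q\<close>. Inside, distances
  to \<open>A\<close> are at most \<open>M / q + M\<close> and the kernel of order \<open>s0\<close>
  dominates; outside, \<open>norm x \<le> q * norm y\<close> and the kernel is comparable to its
  value at \<open>y\<close>.\<close>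

lemma interaction_le:
  fixes A B :: "'a::euclidean_space set"
  assumes [measurable]: "A \<in> sets borel" "B \<in> sets borel"
    and A: "A \<subseteq> ball 0 M" and M: "1 \<le> M" and q: "0 < q" "q < 1" and s: "0 < s" "s \<le> s0" "s0 < 1"
  shows "interaction s A B \<le> ennreal (M / q + M) * interaction s0 A B
    + ennreal (1 / (1 - q) ^ (DIM('a) + 1)) * (emeasure lborel A * tail (M / q) s B)"
proof -
  define K where "K = ennreal (M / q + M)"
  define c where "c = ennreal (1 / (1 - q) ^ (DIM('a) + 1))"
  let ?F = "B \<inter> - ball 0 (M / q)"
  have Mq: "1 \<le> M / q" using M q by (simp add: pos_le_divide_eq)
  have pt: "ennreal (riesz_kernel s (x - y)) * indicator B y \<le>
      K * (ennreal (riesz_kernel s0 (x - y)) * indicator B y) + c * (ennreal (riesz_kernel s y) * indicator ?F y)"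
    if x: "x \<in> A" for x y
  proof (cases "y \<in> B")
    case True
    have nx: "norm x < M" using x A by auto
    show ?thesis
    proof (cases "norm y < M / q")
      case yM: True
      have "norm (x - y) \<le> M / q + M" using nx yM norm_triangle_ineq4[of x y] by simp
      then have "riesz_kernel s (x - y) \<le> (M / q + M) * riesz_kernel s0 (x - y)"
        using Mq M s by (intro riesz_kernel_near_le) auto
      then have "ennreal (riesz_kernel s (x - y)) \<le> K * ennreal (riesz_kernel s0 (x - y))"
        unfolding K_def by (subst ennreal_mult''[symmetric]) (auto intro: ennreal_leI)
      then show ?thesis using True by (simp add: add_increasing2)
    next
      case False
      then have "norm x \<le> q * norm y" using nx q by (simp add: field_simps not_less)
      moreover have "y \<noteq> 0" using False Mq by auto
      ultimately have "riesz_kernel s (x - y) \<le> riesz_kernel s y / (1 - q) ^ (DIM('a) + 1)"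
        using q s by (intro riesz_kernel_far_le) auto
      then have "ennreal (riesz_kernel s (x - y)) \<le> c * ennreal (riesz_kernel s y)"
        using q unfolding c_def by (subst ennreal_mult''[symmetric]) (auto intro: ennreal_leI)
      then show ?thesis using True False by (simp add: add_increasing)
    qed
  qed simp
  have "interaction s A B \<le> (\<integral>\<^sup>+x\<in>A. (\<integral>\<^sup>+y. K * (ennreal (riesz_kernel s0 (x - y)) * indicator B y)
      + c * (ennreal (riesz_kernel s y) * indicator ?F y) \<partial>lborel) \<partial>lborel)"
    unfolding interaction_altdef
    by (intro nn_integral_mono) (auto simp: indicator_def[of A] intro!: nn_integral_mono pt)
  also have "\<dots> = (\<integral>\<^sup>+x\<in>A. K * (\<integral>\<^sup>+y\<in>B. ennreal (riesz_kernel s0 (x - y)) \<partial>lborel) + c * tail (M / q) s B \<partial>lborel)"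
    unfolding tail_def by (subst nn_integral_add) (simp_all add: nn_integral_cmult)
  also have "\<dots> = (\<integral>\<^sup>+x. K * ((\<integral>\<^sup>+y\<in>B. ennreal (riesz_kernel s0 (x - y)) \<partial>lborel) * indicator A x) \<partial>lborel)
       + (\<integral>\<^sup>+x. c * tail (M / q) s B * indicator A x \<partial>lborel)"
    by (subst nn_integral_add[symmetric]) (auto simp: distrib_right distrib_left mult_ac)
  also have "\<dots> = K * interaction s0 A B + c * (emeasure lborel A * tail (M / q) s B)"
    unfolding interaction_altdef by (subst nn_integral_cmult) (simp_all add: nn_integral_cmult mult_ac)
  finally show ?thesis unfolding K_def c_def .
qed

text \<open>The part of \<open>B\<close> inside the ball of radius \<open>M / q\<close> is
  discarded, and on the rest the far comparison of the kernels applies.\<close>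

lemma interaction_ge:
  fixes A B :: "'a::euclidean_space set"
  assumes [measurable]: "A \<in> sets borel" "B \<in> sets borel"
    and A: "A \<subseteq> ball 0 M" and M: "1 \<le> M" and q: "0 < q" "q < 1" and s: "0 < s" "s < 1"
  shows "ennreal (1 / (1 + q) ^ (DIM('a) + 1)) * (emeasure lborel A * tail (M / q) s B) \<le> interaction s A B"
proof -
  define c where "c = ennreal (1 / (1 + q) ^ (DIM('a) + 1))"
  let ?F = "B \<inter> - ball 0 (M / q)"
  have Mq: "1 \<le> M / q" using M q by (simp add: pos_le_divide_eq)
  have pt: "c * (ennreal (riesz_kernel s y) * indicator ?F y) \<le> ennreal (riesz_kernel s (x - y)) * indicator B y"
    if x: "x \<in> A" for x y
  proof (cases "y \<in> ?F")
    case True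
    have nx: "norm x < M" using x A by auto
    then have "norm x \<le> q * norm y" using q True by (simp add: field_simps not_less)
    moreover have "y \<noteq> 0" using True Mq by auto
    ultimately have "riesz_kernel s y / (1 + q) ^ (DIM('a) + 1) \<le> riesz_kernel s (x - y)"
      using q s by (intro riesz_kernel_far_le) auto
    then have "c * ennreal (riesz_kernel s y) \<le> ennreal (riesz_kernel s (x - y))"
      using q unfolding c_def by (subst ennreal_mult''[symmetric]) (auto intro: ennreal_leI)
    then show ?thesis using True by simp
  qed simp
  have "c * (emeasure lborel A * tail (M / q) s B) = (\<integral>\<^sup>+x. c * tail (M / q) s B * indicator A x \<partial>lborel)"
    by (subst nn_integral_cmult_indicator) (auto simp: mult_ac)
  also have "\<dots> = (\<integral>\<^sup>+x\<in>A. (\<integral>\<^sup>+y. c * (ennreal (riesz_kernel s y) * indicator ?F y) \<partial>lborel) \<partial>lborel)"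
    unfolding tail_def by (subst nn_integral_cmult) auto
  also have "\<dots> \<le> interaction s A B"
    unfolding interaction_altdef
    by (intro nn_integral_mono) (auto simp: indicator_def[of A] intro!: nn_integral_mono pt)
  finally show ?thesis unfolding c_def .
qed

section \<open>Tails of a set and of its complement\<close>

text \<open>Instead of polar coordinates, the kernel at \<open>y\<close> is written as the integral
  of \<open>f\<close> from \<open>norm y\<close> to infinity. Exchanging the integrals leaves the
  volumes of annuli, and hence a one-dimensional integral with an explicit antiderivative.\<close>

lemma tail_UNIV:
  assumes s: "0 < s"
  shows "tail 1 s (UNIV :: 'a::euclidean_space set) = ennreal (sphere_measure TYPE('a) / s)"
proof -
  define N where "N = DIM('a)"
  define \<omega> where "\<omega> = unit_ball_vol (real N)"
  define p where "p = real N + s"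
  have p: "p > 0" using s by (simp add: p_def add_nonneg_pos)
  have \<omega>: "\<omega> > 0" by (simp add: \<omega>_def)
  define f where "f r = p * r powr (- p - 1)" for r :: real
  have [measurable]: "f \<in> borel_measurable borel" unfolding f_def by measurable
  have f0: "0 \<le> f r" for r using p by (simp add: f_def)
  have rk: "ennreal (riesz_kernel s y) = (\<integral>\<^sup>+r. ennreal (f r) * indicator {norm y..} r \<partial>lborel)"
    if "1 \<le> norm y" for y :: 'a
  proof -
    have "(\<integral>\<^sup>+r. ennreal (f r) * indicator {norm y..} r \<partial>lborel) = ennreal (0 - (- (norm y powr (- p))))"
    proof (rule nn_integral_FTC_atLeast)
      show "DERIV (\<lambda>r. - (r powr - p)) r :> f r" if "norm y \<le> r" for r
        using that \<open>1 \<le> norm y\<close> by (auto simp: f_def intro!: derivative_eq_intros)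
      have "((\<lambda>r. - (r powr - p)) \<longlongrightarrow> - 0) at_top"
        using p by (intro tendsto_minus tendsto_neg_powr filterlim_ident) auto
      then show "((\<lambda>r. - (r powr - p)) \<longlongrightarrow> 0) at_top" by simp
    qed (auto simp: f0)
    moreover have "riesz_kernel s y = 0 - (- (norm y powr (- p)))"
      by (simp only: riesz_kernel_def powr_minus p_def N_def inverse_eq_divide diff_0 minus_minus)
    ultimately show ?thesis by simp
  qed
  have "tail 1 s (UNIV :: 'a set) = (\<integral>\<^sup>+y. \<integral>\<^sup>+r. ennreal (f r) * indicator {(r, y). 1 \<le> norm y \<and> norm y \<le> r} (r, y :: 'a) \<partial>lborel \<partial>lborel)"
    unfolding tail_def
  proof (rule nn_integral_cong)
    fix y :: 'a
    show "ennreal (riesz_kernel s y) * indicator (UNIV \<inter> - ball 0 1) y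
      = (\<integral>\<^sup>+r. ennreal (f r) * indicator {(r, y). 1 \<le> norm y \<and> norm y \<le> r} (r, y) \<partial>lborel)"
      by (cases "1 \<le> norm y") (auto simp: rk indicator_def intro!: nn_integral_cong)
  qed
  also have "\<dots> = (\<integral>\<^sup>+r. \<integral>\<^sup>+y. ennreal (f r) * indicator {(r, y). 1 \<le> norm y \<and> norm y \<le> r} (r, y :: 'a) \<partial>lborel \<partial>lborel)"
    by (rule lborel_pair.Fubini') measurable
  also have "\<dots> = (\<integral>\<^sup>+r. ennreal (f r * (\<omega> * (r ^ N - 1))) * indicator {1..} r \<partial>lborel)"
  proof (rule nn_integral_cong)
    fix r :: real
    show "(\<integral>\<^sup>+y. ennreal (f r) * indicator {(r, y). 1 \<le> norm y \<and> norm y \<le> r} (r, y :: 'a) \<partial>lborel)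
      = ennreal (f r * (\<omega> * (r ^ N - 1))) * indicator {1..} r"
    proof (cases "1 \<le> r")
      case True
      have "(\<integral>\<^sup>+y. ennreal (f r) * indicator {(r, y). 1 \<le> norm y \<and> norm y \<le> r} (r, y :: 'a) \<partial>lborel)
          = (\<integral>\<^sup>+y. ennreal (f r) * indicator (cball 0 r - ball 0 1 :: 'a set) y \<partial>lborel)"
        by (intro nn_integral_cong) (auto simp: indicator_def)
      also have "\<dots> = ennreal (f r) * emeasure lborel (cball 0 r - ball 0 1 :: 'a set)"
        by (rule nn_integral_cmult_indicator) simp
      also have "emeasure lborel (cball 0 r - ball 0 1 :: 'a set)
          = emeasure lborel (cball 0 r :: 'a set) - emeasure lborel (ball 0 1 :: 'a set)"
        using True by (intro emeasure_Diff) (auto simp: emeasure_ball)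
      also have "\<dots> = ennreal (\<omega> * (r ^ N - 1))"
        using True by (simp add: emeasure_ball emeasure_cball ennreal_minus algebra_simps \<omega>_def N_def)
      finally show ?thesis using True f0 by (simp add: ennreal_mult')
    next
      case False
      then have "(\<integral>\<^sup>+y. ennreal (f r) * indicator {(r, y). 1 \<le> norm y \<and> norm y \<le> r} (r, y :: 'a) \<partial>lborel) = (\<integral>\<^sup>+(y::'a). 0 \<partial>lborel)"
        by (intro nn_integral_cong) (auto simp: indicator_def)
      then show ?thesis using False by simp
    qed
  qed
  also have "\<dots> = ennreal (0 - \<omega> * (1 powr (- p) - p / s * 1 powr (- s)))"
  proof (rule nn_integral_FTC_atLeast)
    show "DERIV (\<lambda>r. \<omega> * (r powr (- p) - p / s * r powr (- s))) r :> f r * (\<omega> * (r ^ N - 1))" if "1 \<le> r" for r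
    proof -
      have "f r * r ^ N = p * r powr (- s - 1)"
        using that by (simp add: f_def powr_realpow[symmetric] powr_add[symmetric] p_def mult.assoc)
      then have "f r * (\<omega> * (r ^ N - 1)) = \<omega> * (p * r powr (- s - 1) - f r)"
        by (simp add: algebra_simps)
      moreover have "DERIV (\<lambda>r. \<omega> * (r powr (- p) - p / s * r powr (- s))) r :> \<omega> * (p * r powr (- s - 1) - f r)"
        using that s by (auto simp: f_def intro!: derivative_eq_intros)
      ultimately show ?thesis by (simp only:)
    qed
    show "0 \<le> f r * (\<omega> * (r ^ N - 1))" if "1 \<le> r" for r
      using f0 \<omega> that by (auto intro!: mult_nonneg_nonneg)
    have "((\<lambda>r. \<omega> * (r powr (- p) - p / s * r powr (- s))) \<longlongrightarrow> \<omega> * (0 - p / s * 0)) at_top"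
      using p s by (intro tendsto_intros tendsto_neg_powr filterlim_ident) auto
    then show "((\<lambda>r. \<omega> * (r powr (- p) - p / s * r powr (- s))) \<longlongrightarrow> 0) at_top" by simp
  qed auto
  \<comment> \<open>Here \<open>p / s - 1 = n / s\<close> because \<open>p = n + s\<close>.\<close>
  also have "0 - \<omega> * (1 powr (- p) - p / s * 1 powr (- s)) = sphere_measure TYPE('a) / s"
    using s by (simp add: sphere_measure_eq \<omega>_def N_def p_def field_simps)
  finally show ?thesis .
qed


lemma ennreal_mult_lincomb:
  assumes "0 \<le> c" "0 \<le> a" "0 \<le> b" "0 \<le> x" "0 \<le> y"
  shows "ennreal c * (ennreal a * ennreal x + ennreal b * ennreal y) = ennreal (c * (a * x + b * y))"
  using assms by (simp add: ennreal_mult)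

lemma tail_mono: "\<rho> \<le> \<rho>' \<Longrightarrow> tail \<rho>' s F \<le> tail \<rho> s F"
  unfolding tail_def by (intro nn_integral_mono) (auto simp: indicator_def)

text \<open>Outside the unit ball the kernel is at most \<open>1\<close>, so enlarging the excluded
  ball costs at most its volume. This error does not depend on \<open>s\<close> and disappears after
  multiplication by \<open>s\<close>.\<close>

lemma tail_1_le:
  assumes [measurable]: "F \<in> sets borel" and \<rho>: "1 \<le> \<rho>" and s: "0 < s"
  shows "tail 1 s (F :: 'a::euclidean_space set)
    \<le> tail \<rho> s F + ennreal (unit_ball_vol (DIM('a)) * \<rho> ^ DIM('a))"
proof -
  have "tail 1 s F \<le> (\<integral>\<^sup>+y. ennreal (riesz_kernel s y) * indicator (F \<inter> - ball 0 \<rho>) y + indicator (cball 0 \<rho> :: 'a set) y \<partial>lborel)"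
    unfolding tail_def
  proof (rule nn_integral_mono)
    fix y :: 'a
    have "riesz_kernel s y \<le> 1" if "1 \<le> norm y"
      using frac_le[of 1 1 1 "norm y powr (real DIM('a) + s)"] that s
      by (simp add: riesz_kernel_def ge_one_powr_ge_zero)
    then show "ennreal (riesz_kernel s y) * indicator (F \<inter> - ball 0 1) y
        \<le> ennreal (riesz_kernel s y) * indicator (F \<inter> - ball 0 \<rho>) y + indicator (cball 0 \<rho>) y"
      by (auto simp: indicator_def ennreal_le_1)
  qed
  also have "\<dots> = tail \<rho> s F + emeasure lborel (cball 0 \<rho> :: 'a set)"
    unfolding tail_def by (subst nn_integral_add) (auto intro!: borel_measurable_indicator)
  finally show ?thesis using \<rho> by (simp add: emeasure_cball)
qed

lemma tail_add_Compl:
  assumes [measurable]: "F \<in> sets borel"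
  shows "tail \<rho> s (F :: 'a set) + tail \<rho> s (- F) = tail \<rho> s (UNIV :: 'a::euclidean_space set)"
proof -
  have "tail \<rho> s F + tail \<rho> s (- F) = (\<integral>\<^sup>+y. ennreal (riesz_kernel s y) * indicator (F \<inter> - ball 0 \<rho>) y
      + ennreal (riesz_kernel s y) * indicator (- F \<inter> - ball 0 \<rho>) y \<partial>lborel)"
    unfolding tail_def by (rule nn_integral_add[symmetric]) measurable
  also have "\<dots> = tail \<rho> s (UNIV :: 'a set)"
    unfolding tail_def by (intro nn_integral_cong) (auto simp: indicator_def)
  finally show ?thesis .
qed

text \<open>The tail is part of the finite tail of the whole space, so the real-valued integral
  agrees with the nonnegative one and is not merely a default value.\<close>

lemma tail_eq_weighted_tail:
  fixes F :: "'a::euclidean_space set"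
  assumes [measurable]: "F \<in> sets borel" and s: "0 < s"
  shows "tail 1 s F = ennreal (weighted_tail F s / s)" "0 \<le> weighted_tail F s"
proof -
  have "tail 1 s F \<le> tail 1 s F + tail 1 s (- F)" by simp
  also have "\<dots> < \<infinity>" unfolding tail_add_Compl[OF assms(1)] tail_UNIV[OF s] by simp
  finally have fin: "tail 1 s F < \<infinity>" .
  have "weighted_tail F s = s * (LINT y|lebesgue. indicator (F \<inter> - ball 0 1) y * riesz_kernel s y)"
    by (simp add: weighted_tail_def set_lebesgue_integral_def riesz_kernel_def)
  also have "(LINT y|lebesgue. indicator (F \<inter> - ball 0 1) y * riesz_kernel s y)
      = (LINT y|lborel. indicator (F \<inter> - ball 0 1) y * riesz_kernel s y)"
    by (rule integral_completion) measurable
  also have "\<dots> = enn2real (tail 1 s F)"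
    unfolding tail_def
    by (subst integral_eq_nn_integral) (auto intro!: arg_cong[where f=enn2real] nn_integral_cong simp: indicator_def)
  finally have eq: "weighted_tail F s = s * enn2real (tail 1 s F)" .
  then show "0 \<le> weighted_tail F s" using s by simp
  show "tail 1 s F = ennreal (weighted_tail F s / s)"
    using eq s fin by (simp add: less_top)
qed

lemma weighted_tail_Compl:
  fixes F :: "'a::euclidean_space set"
  assumes F: "F \<in> sets borel" and s: "0 < s"
  shows "weighted_tail (- F) s = sphere_measure TYPE('a) - weighted_tail F s"
proof -
  have F': "- F \<in> sets borel" using F by auto
  have "ennreal (weighted_tail F s / s + weighted_tail (- F) s / s) = ennreal (sphere_measure TYPE('a) / s)"
    using tail_add_Compl[OF F, of 1 s] tail_eq_weighted_tail[OF F s] tail_eq_weighted_tail[OF F' s] s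
    by (simp add: tail_UNIV)
  then have "weighted_tail F s / s + weighted_tail (- F) s / s = sphere_measure TYPE('a) / s"
    using tail_eq_weighted_tail(2)[OF F s] tail_eq_weighted_tail(2)[OF F' s] s
    by (subst (asm) ennreal_inj) (auto simp: sphere_measure_def)
  then show ?thesis using s by (simp add: field_simps)
qed

section \<open>Two-sided bounds for the perimeter and the limit\<close>

text \<open>The set \<open>E\<close> is Borel here; a Lebesgue measurable set is later replaced by a
  Borel set that differs from it by a null set. The bound \<open>1 \<le> M\<close> ensures that the
  splitting radius \<open>M / q\<close> is at least \<open>1\<close>.\<close>

locale perimeter_bounds =
  fixes E \<Omega> :: "'a::euclidean_space set" and M s0 :: real
  assumes E: "E \<in> sets borel" and \<Omega>: "\<Omega> \<in> sets borel" "\<Omega> \<subseteq> ball 0 M" and M: "1 \<le> M"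
    and s0: "0 < s0" "s0 < 1" and finite_perimeter: "s_perimeter s0 E \<Omega> < \<infinity>"
begin

lemma sets_measurable [measurable]:
  "E \<in> sets borel" "\<Omega> \<in> sets borel" "E \<inter> \<Omega> \<in> sets borel" "- E \<inter> \<Omega> \<in> sets borel"
  "E \<inter> - \<Omega> \<in> sets borel" "- E \<inter> - \<Omega> \<in> sets borel" "- E \<in> sets borel"
  using E \<Omega> by auto

definition vol_in where "vol_in = measure lborel (E \<inter> \<Omega>)"

definition vol_out where "vol_out = measure lborel (- E \<inter> \<Omega>)"

lemma emeasure_parts:
  "emeasure lborel (E \<inter> \<Omega>) = ennreal vol_in" "emeasure lborel (- E \<inter> \<Omega>) = ennreal vol_out"
proof -
  have "emeasure lborel A = ennreal (measure lborel A)" if "A \<subseteq> \<Omega>" for A :: "'a set"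
  proof (rule emeasure_eq_ennreal_measure)
    have "bounded A" using that \<Omega>(2) by (blast intro: bounded_subset[OF bounded_ball])
    then show "emeasure lborel A \<noteq> top" using emeasure_bounded_finite[of A] by simp
  qed
  then show "emeasure lborel (E \<inter> \<Omega>) = ennreal vol_in" "emeasure lborel (- E \<inter> \<Omega>) = ennreal vol_out"
    by (auto simp: vol_in_def vol_out_def)
qed

lemma vol_nonneg: "0 \<le> vol_in" "0 \<le> vol_out"
  by (simp_all add: vol_in_def vol_out_def)

context
  fixes s q :: real
  assumes s: "0 < s" "s \<le> s0" and q: "0 < q" "q < 1"
begin

text \<open>The interaction within \<Omega> has no far part, since \<Omega> lies in the ball of
  radius \<open>M / q\<close>. In the last interaction the two sets are exchanged by symmetry, so
  that the bounded one comes first as in \<open>interaction_le\<close>.\<close>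

lemma s_perimeter_le:
  "s_perimeter s E \<Omega> \<le> ennreal (M / q + M) * s_perimeter s0 E \<Omega> +
     ennreal (1 / (1 - q) ^ (DIM('a) + 1)) * (ennreal vol_in * tail 1 s (- E) + ennreal vol_out * tail 1 s E)"
proof -
  let ?K = "ennreal (M / q + M)" and ?c = "ennreal (1 / (1 - q) ^ (DIM('a) + 1))"
  have Mq: "M \<le> M / q" "1 \<le> M / q" using M q by (simp_all add: pos_le_divide_eq)
  note upper = interaction_le[OF _ _ _ M q s s0(2)]
  have "tail (M / q) s (- E \<inter> \<Omega>) = (\<integral>\<^sup>+(y::'a). 0 \<partial>lborel)"
    unfolding tail_def using \<Omega>(2) Mq by (intro nn_integral_cong) (force simp: indicator_def)
  then have 1: "interaction s (E \<inter> \<Omega>) (- E \<inter> \<Omega>) \<le> ?K * interaction s0 (E \<inter> \<Omega>) (- E \<inter> \<Omega>)"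
    using upper[of "E \<inter> \<Omega>" "- E \<inter> \<Omega>"] \<Omega>(2) by auto
  have tail_le: "tail (M / q) s A \<le> tail 1 s B" if "A \<subseteq> B" for A B :: "'a set"
    unfolding tail_def using that Mq by (intro nn_integral_mono) (auto simp: indicator_def)
  have "interaction s (E \<inter> \<Omega>) (- E \<inter> - \<Omega>) \<le> ?K * interaction s0 (E \<inter> \<Omega>) (- E \<inter> - \<Omega>)
      + ?c * (ennreal vol_in * tail (M / q) s (- E \<inter> - \<Omega>))"
    using upper[of "E \<inter> \<Omega>" "- E \<inter> - \<Omega>"] \<Omega>(2) by (auto simp: emeasure_parts)
  also have "\<dots> \<le> ?K * interaction s0 (E \<inter> \<Omega>) (- E \<inter> - \<Omega>) + ?c * (ennreal vol_in * tail 1 s (- E))"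
    by (intro add_left_mono mult_left_mono tail_le) auto
  finally have 2: "interaction s (E \<inter> \<Omega>) (- E \<inter> - \<Omega>) \<le> \<dots>" .
  have "interaction s (E \<inter> - \<Omega>) (- E \<inter> \<Omega>) = interaction s (- E \<inter> \<Omega>) (E \<inter> - \<Omega>)"
    by (rule interaction_commute) measurable
  also have "\<dots> \<le> ?K * interaction s0 (- E \<inter> \<Omega>) (E \<inter> - \<Omega>) + ?c * (ennreal vol_out * tail (M / q) s (E \<inter> - \<Omega>))"
    using upper[of "- E \<inter> \<Omega>" "E \<inter> - \<Omega>"] \<Omega>(2) by (auto simp: emeasure_parts)
  also have "interaction s0 (- E \<inter> \<Omega>) (E \<inter> - \<Omega>) = interaction s0 (E \<inter> - \<Omega>) (- E \<inter> \<Omega>)"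
    by (rule interaction_commute) measurable
  also have "?K * interaction s0 (E \<inter> - \<Omega>) (- E \<inter> \<Omega>) + ?c * (ennreal vol_out * tail (M / q) s (E \<inter> - \<Omega>))
      \<le> ?K * interaction s0 (E \<inter> - \<Omega>) (- E \<inter> \<Omega>) + ?c * (ennreal vol_out * tail 1 s E)"
    by (intro add_left_mono mult_left_mono tail_le) auto
  finally have 3: "interaction s (E \<inter> - \<Omega>) (- E \<inter> \<Omega>) \<le> \<dots>" .
  show ?thesis
    unfolding s_perimeter_def
    by (rule order.trans[OF add_mono[OF add_mono[OF 1 2] 3]]) (simp add: distrib_left add_ac del: ennreal_plus)
qed

text \<open>The interaction within \<Omega> is dropped. Beyond the radius \<open>M / q\<close> there
  are no points of \<Omega>, so the tails are those of the full sets \<open>E\<close> and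
  \<open>- E\<close>.\<close>

lemma s_perimeter_ge:
  "ennreal (1 / (1 + q) ^ (DIM('a) + 1)) * (ennreal vol_in * tail (M / q) s (- E) + ennreal vol_out * tail (M / q) s E)
    \<le> s_perimeter s E \<Omega>"
proof -
  let ?c = "ennreal (1 / (1 + q) ^ (DIM('a) + 1))"
  have Mq: "M \<le> M / q" using M q by (simp add: pos_le_divide_eq)
  have s1: "s < 1" using s s0 by simp
  note lower = interaction_ge[OF _ _ _ M q s(1) s1]
  have eq: "tail (M / q) s (A \<inter> - \<Omega>) = tail (M / q) s A" for A
  proof -
    have "A \<inter> - \<Omega> \<inter> - ball 0 (M / q) = A \<inter> - ball 0 (M / q)" using \<Omega>(2) Mq by force
    then show ?thesis by (simp add: tail_def)
  qed
  have "?c * (ennreal vol_in * tail (M / q) s (- E)) \<le> interaction s (E \<inter> \<Omega>) (- E \<inter> - \<Omega>)"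
    using lower[of "E \<inter> \<Omega>" "- E \<inter> - \<Omega>"] \<Omega>(2) by (auto simp: emeasure_parts eq)
  moreover have "?c * (ennreal vol_out * tail (M / q) s E) \<le> interaction s (- E \<inter> \<Omega>) (E \<inter> - \<Omega>)"
    using lower[of "- E \<inter> \<Omega>" "E \<inter> - \<Omega>"] \<Omega>(2) by (auto simp: emeasure_parts eq)
  moreover have "interaction s (- E \<inter> \<Omega>) (E \<inter> - \<Omega>) = interaction s (E \<inter> - \<Omega>) (- E \<inter> \<Omega>)"
    by (rule interaction_commute) measurable
  ultimately have "?c * (ennreal vol_in * tail (M / q) s (- E)) + ?c * (ennreal vol_out * tail (M / q) s E)
      \<le> interaction s (E \<inter> \<Omega>) (- E \<inter> - \<Omega>) + interaction s (E \<inter> - \<Omega>) (- E \<inter> \<Omega>)"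
    by (intro add_mono) simp_all
  also have "\<dots> \<le> s_perimeter s E \<Omega>"
    unfolding s_perimeter_def by (simp add: add.assoc add_increasing)
  finally show ?thesis by (simp add: distrib_left)
qed

end

text \<open>The expression to which \<open>s\<close> times the perimeter is compared at a fixed
  \<open>s\<close>; its limit is the value sought.\<close>

definition limit_profile where
  "limit_profile s = vol_in * weighted_tail (- E) s + vol_out * weighted_tail E s"

text \<open>For \<open>0 < s \<le> s0\<close> the perimeter is finite, as shown next, so that
  passing to real numbers loses no information.\<close>

definition real_perimeter where
  "real_perimeter s = enn2real (s_perimeter s E \<Omega>)"

lemma real_perimeter_upper:
  assumes s: "0 < s" "s \<le> s0" and q: "0 < q" "q < 1"
  shows "s_perimeter s E \<Omega> = ennreal (real_perimeter s)"
    and "s * real_perimeter s \<le> s * ((M / q + M) * real_perimeter s0) + limit_profile s / (1 - q) ^ (DIM('a) + 1)"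
proof -
  let ?c = "1 / (1 - q) ^ (DIM('a) + 1)"
  note wt = tail_eq_weighted_tail[OF sets_measurable(1) s(1)] tail_eq_weighted_tail[OF sets_measurable(7) s(1)]
  have P0: "s_perimeter s0 E \<Omega> = ennreal (real_perimeter s0)" "0 \<le> real_perimeter s0"
    using finite_perimeter by (auto simp: real_perimeter_def less_top)
  have K: "0 \<le> M / q + M" using M q by simp
  have prof: "0 \<le> limit_profile s" using vol_nonneg wt by (simp add: limit_profile_def)
  have "ennreal (M / q + M) * s_perimeter s0 E \<Omega> +
      ennreal ?c * (ennreal vol_in * tail 1 s (- E) + ennreal vol_out * tail 1 s E)
    = ennreal ((M / q + M) * real_perimeter s0 + ?c * (limit_profile s / s))"
  proof -
    have "ennreal ?c * (ennreal vol_in * tail 1 s (- E) + ennreal vol_out * tail 1 s E)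
        = ennreal (?c * (vol_in * (weighted_tail (- E) s / s) + vol_out * (weighted_tail E s / s)))"
      unfolding wt(1,3) using vol_nonneg wt(2,4) q s by (intro ennreal_mult_lincomb) auto
    also have "vol_in * (weighted_tail (- E) s / s) + vol_out * (weighted_tail E s / s) = limit_profile s / s"
      by (simp add: limit_profile_def add_divide_distrib)
    finally have 1: "ennreal ?c * (ennreal vol_in * tail 1 s (- E) + ennreal vol_out * tail 1 s E)
        = ennreal (?c * (limit_profile s / s))" .
    show ?thesis
      unfolding 1 P0(1) using K P0(2) q s prof
      by (subst ennreal_plus) (auto simp: ennreal_mult' simp del: ennreal_plus)
  qed
  then have le: "s_perimeter s E \<Omega> \<le> ennreal ((M / q + M) * real_perimeter s0 + ?c * (limit_profile s / s))"
    using s_perimeter_le[OF s q] by simp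
  then have "s_perimeter s E \<Omega> < \<infinity>" by (rule le_less_trans) simp
  then show eq: "s_perimeter s E \<Omega> = ennreal (real_perimeter s)"
    by (auto simp: real_perimeter_def less_top)
  have "real_perimeter s \<le> (M / q + M) * real_perimeter s0 + ?c * (limit_profile s / s)"
    using le P0(2) K q s prof unfolding eq by (subst (asm) ennreal_le_iff) auto
  then have "s * real_perimeter s \<le> s * ((M / q + M) * real_perimeter s0 + ?c * (limit_profile s / s))"
    using s by (intro mult_left_mono) auto
  also have "\<dots> = s * ((M / q + M) * real_perimeter s0) + limit_profile s / (1 - q) ^ (DIM('a) + 1)"
    using s by (simp add: distrib_left)
  finally show "s * real_perimeter s \<le> s * ((M / q + M) * real_perimeter s0) + limit_profile s / (1 - q) ^ (DIM('a) + 1)" .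
qed

text \<open>Passing from the tails beyond \<open>M / q\<close> to those beyond \<open>1\<close>
  costs at most the volume \<open>V\<close> of the ball of radius \<open>M / q\<close> for each
  tail, hence an error of order \<open>s\<close> after multiplication by \<open>s\<close>.\<close>

lemma real_perimeter_lower:
  assumes s: "0 < s" "s \<le> s0" and q: "0 < q" "q < 1"
  shows "(limit_profile s - s * ((vol_in + vol_out) * (unit_ball_vol (DIM('a)) * (M / q) ^ DIM('a)))) / (1 + q) ^ (DIM('a) + 1)
    \<le> s * real_perimeter s"
proof -
  let ?c = "1 / (1 + q) ^ (DIM('a) + 1)"
  define V where "V = unit_ball_vol (DIM('a)) * (M / q) ^ DIM('a)"
  have Mq: "1 \<le> M / q" using M q by (simp add: pos_le_divide_eq)
  have V: "0 \<le> V" using Mq by (simp add: V_def)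
  have tail_bound: "\<exists>t\<ge>0. tail (M / q) s F = ennreal t \<and> weighted_tail F s \<le> s * t + s * V"
    if F: "F \<in> sets borel" for F :: "'a set"
  proof -
    note wt = tail_eq_weighted_tail[OF F s(1)]
    have "tail (M / q) s F \<le> ennreal (weighted_tail F s / s)" using tail_mono[OF Mq, of s F] by (simp add: wt)
    then have "tail (M / q) s F < \<infinity>" by (rule le_less_trans) simp
    then obtain t where t: "tail (M / q) s F = ennreal t" "0 \<le> t" by (cases "tail (M / q) s F") auto
    have "ennreal (weighted_tail F s / s) \<le> ennreal (t + V)"
      using tail_1_le[OF F Mq s(1)] t V by (simp add: wt V_def)
    then have "weighted_tail F s / s \<le> t + V" using t V by (subst (asm) ennreal_le_iff) auto
    then have "weighted_tail F s \<le> s * t + s * V" using s by (simp add: pos_divide_le_eq algebra_simps)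
    with t show ?thesis by blast
  qed
  obtain t1 where t1: "0 \<le> t1" "tail (M / q) s (- E) = ennreal t1" "weighted_tail (- E) s \<le> s * t1 + s * V"
    using tail_bound[OF sets_measurable(7)] by blast
  obtain t2 where t2: "0 \<le> t2" "tail (M / q) s E = ennreal t2" "weighted_tail E s \<le> s * t2 + s * V"
    using tail_bound[OF sets_measurable(1)] by blast
  have "ennreal (?c * (vol_in * t1 + vol_out * t2)) \<le> ennreal (real_perimeter s)"
    using s_perimeter_ge[OF s q] q t1(1) t2(1) vol_nonneg
    unfolding real_perimeter_upper(1)[OF s q] t1(2) t2(2) by (subst (asm) ennreal_mult_lincomb) auto
  then have 1: "?c * (vol_in * t1 + vol_out * t2) \<le> real_perimeter s"
    by (subst (asm) ennreal_le_iff) (simp add: real_perimeter_def)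
  have "vol_in * weighted_tail (- E) s \<le> vol_in * (s * t1 + s * V)" "vol_out * weighted_tail E s \<le> vol_out * (s * t2 + s * V)"
    using t1 t2 vol_nonneg by (auto intro: mult_left_mono)
  then have "limit_profile s - s * ((vol_in + vol_out) * V) \<le> s * (vol_in * t1 + vol_out * t2)"
    by (simp add: limit_profile_def algebra_simps)
  then have "(limit_profile s - s * ((vol_in + vol_out) * V)) * ?c \<le> s * (vol_in * t1 + vol_out * t2) * ?c"
    using q by (intro mult_right_mono) auto
  also have "\<dots> = s * (?c * (vol_in * t1 + vol_out * t2))" by simp
  also have "\<dots> \<le> s * real_perimeter s" using 1 s by (intro mult_left_mono) auto
  finally show ?thesis by (simp add: V_def)
qed

text \<open>The order of the limits matters, because the error terms blow up as \<open>q\<close>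
  tends to \<open>0\<close>. First \<open>q\<close> is chosen so small that the factors
  \<open>(1 - q)\<close> or \<open>(1 + q)\<close> move \<open>Q\<close> by little; then, for this
  fixed \<open>q\<close>, the errors vanish as \<open>s\<close> tends to \<open>0\<close>.\<close>

lemma s_perimeter_tendsto:
  assumes a: "(weighted_tail E \<longlongrightarrow> a) (at_right 0)"
  shows "((\<lambda>s. ennreal s * s_perimeter s E \<Omega>)
    \<longlongrightarrow> ennreal (vol_in * (sphere_measure TYPE('a) - a) + vol_out * a)) (at_right 0)"
proof -
  let ?n = "DIM('a) + 1"
  define Q where "Q = vol_in * (sphere_measure TYPE('a) - a) + vol_out * a"
  have ev: "\<forall>\<^sub>F s in at_right 0. 0 < s \<and> s \<le> s0"
    using s0(1) by (auto simp: eventually_at_right_field intro!: exI[of _ s0])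
  have "((\<lambda>s. vol_in * (sphere_measure TYPE('a) - weighted_tail E s) + vol_out * weighted_tail E s) \<longlongrightarrow> Q) (at_right 0)"
    unfolding Q_def by (intro tendsto_intros a)
  then have prof: "(limit_profile \<longlongrightarrow> Q) (at_right 0)"
    by (rule Lim_transform_eventually)
       (use ev in eventually_elim, simp add: limit_profile_def weighted_tail_Compl[OF E])
  have id: "((\<lambda>s. s) \<longlongrightarrow> (0::real)) (at_right 0)" by (rule tendsto_ident_at)
  have qev: "\<forall>\<^sub>F q in at_right 0. 0 < q \<and> q < (1::real)"
    by (auto simp: eventually_at_right_field intro!: exI[of _ 1])
  have "((\<lambda>s. s * real_perimeter s) \<longlongrightarrow> Q) (at_right 0)"
  proof (rule order_tendstoI)
    fix u assume u: "Q < u"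
    have "((\<lambda>q. Q / (1 - q) ^ ?n) \<longlongrightarrow> Q / (1 - 0) ^ ?n) (at_right 0)"
      by (intro tendsto_intros id) auto
    then have "\<forall>\<^sub>F q in at_right 0. Q / (1 - q) ^ ?n < u"
      by (rule order_tendstoD) (use u in simp)
    with qev have "\<forall>\<^sub>F q in at_right 0. (0 < q \<and> q < 1) \<and> Q / (1 - q) ^ ?n < u" by (rule eventually_conj)
    then obtain q where q: "0 < q" "q < 1" "Q / (1 - q) ^ ?n < u"
      using eventually_happens'[OF trivial_limit_at_right_real] by blast
    have "((\<lambda>s. s * ((M / q + M) * real_perimeter s0) + limit_profile s / (1 - q) ^ ?n)
        \<longlongrightarrow> 0 * ((M / q + M) * real_perimeter s0) + Q / (1 - q) ^ ?n) (at_right 0)"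
      using q by (intro tendsto_intros id prof) auto
    then have "\<forall>\<^sub>F s in at_right 0. s * ((M / q + M) * real_perimeter s0) + limit_profile s / (1 - q) ^ ?n < u"
      by (rule order_tendstoD) (use q in simp)
    with ev show "\<forall>\<^sub>F s in at_right 0. s * real_perimeter s < u"
      by eventually_elim (use real_perimeter_upper(2)[OF _ _ q(1,2)] in \<open>blast intro: le_less_trans\<close>)
  next
    fix u assume u: "u < Q"
    have "((\<lambda>q. Q / (1 + q) ^ ?n) \<longlongrightarrow> Q / (1 + 0) ^ ?n) (at_right 0)"
      by (intro tendsto_intros id) auto
    then have "\<forall>\<^sub>F q in at_right 0. u < Q / (1 + q) ^ ?n"
      by (rule order_tendstoD) (use u in simp)
    with qev have "\<forall>\<^sub>F q in at_right 0. (0 < q \<and> q < 1) \<and> u < Q / (1 + q) ^ ?n" by (rule eventually_conj)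
    then obtain q where q: "0 < q" "q < 1" "u < Q / (1 + q) ^ ?n"
      using eventually_happens'[OF trivial_limit_at_right_real] by blast
    let ?W = "(vol_in + vol_out) * (unit_ball_vol (DIM('a)) * (M / q) ^ DIM('a))"
    have "((\<lambda>s. (limit_profile s - s * ?W) / (1 + q) ^ ?n) \<longlongrightarrow> (Q - 0 * ?W) / (1 + q) ^ ?n) (at_right 0)"
      using q by (intro tendsto_intros id prof) auto
    then have "\<forall>\<^sub>F s in at_right 0. u < (limit_profile s - s * ?W) / (1 + q) ^ ?n"
      by (rule order_tendstoD) (use q in simp)
    with ev show "\<forall>\<^sub>F s in at_right 0. u < s * real_perimeter s"
      by eventually_elim (use real_perimeter_lower[OF _ _ q(1,2)] in \<open>blast intro: less_le_trans\<close>)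
  qed
  then have "((\<lambda>s. ennreal (s * real_perimeter s)) \<longlongrightarrow> ennreal Q) (at_right 0)" by (rule tendsto_ennrealI)
  moreover have "\<forall>\<^sub>F s in at_right 0. ennreal (s * real_perimeter s) = ennreal s * s_perimeter s E \<Omega>"
    \<comment> \<open>The identity of the real and the extended perimeter is free of
      \<open>q\<close>, so any admissible value can be inserted.\<close>
    using ev by eventually_elim (simp add: real_perimeter_upper(1)[where q="1/2"] ennreal_mult')
  ultimately show ?thesis unfolding Q_def by (rule Lim_transform_eventually)
qed

end

section \<open>Reduction to Borel sets and conclusion\<close>

lemma interaction_cong_AE:
  assumes A: "AE x in lebesgue. x \<in> A \<longleftrightarrow> x \<in> A'" and B: "AE x in lebesgue. x \<in> B \<longleftrightarrow> x \<in> B'"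
  shows "interaction s A B = interaction s A' B'"
proof -
  have "(\<integral>\<^sup>+y\<in>B. ennreal (1 / norm (x - y) powr (real DIM('a) + s)) \<partial>lebesgue)
      = (\<integral>\<^sup>+y\<in>B'. ennreal (1 / norm (x - y) powr (real DIM('a) + s)) \<partial>lebesgue)" for x
    by (rule nn_integral_cong_AE) (use B in eventually_elim, auto simp: indicator_def)
  then show ?thesis
    unfolding interaction_def
    by (intro nn_integral_cong_AE) (use A in eventually_elim, auto simp: indicator_def)
qed

lemma s_perimeter_cong_AE:
  assumes "AE x in lebesgue. x \<in> E \<longleftrightarrow> x \<in> E'"
  shows "s_perimeter s E \<Omega> = s_perimeter s E' \<Omega>"
  unfolding s_perimeter_def
  by (intro arg_cong2[where f="(+)"] interaction_cong_AE) (use assms in \<open>eventually_elim, auto\<close>)+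

lemma weighted_tail_cong_AE:
  assumes "AE x in lebesgue. x \<in> E \<longleftrightarrow> x \<in> E'" "E \<in> sets lebesgue" "E' \<in> sets lebesgue"
  shows "weighted_tail E s = weighted_tail (E' :: 'a::euclidean_space set) s"
proof -
  have ball: "- ball 0 1 \<in> sets (lebesgue :: 'a measure)" by simp
  have m: "(\<lambda>y::'a. 1 / norm y powr (real DIM('a) + s)) \<in> borel_measurable lebesgue"
    by (rule measurable_completion) measurable
  show ?thesis
    unfolding weighted_tail_def set_lebesgue_integral_def
  proof (intro arg_cong[where f="(*) s"] integral_cong_AE)
    show "AE y in lebesgue. indicator (E \<inter> - ball 0 1) y *\<^sub>R (1 / norm y powr (real DIM('a) + s)) =
        indicator (E' \<inter> - ball 0 1) y *\<^sub>R (1 / norm y powr (real DIM('a) + s))"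
      using assms(1) by eventually_elim (auto simp: indicator_def)
  qed (intro borel_measurable_scaleR borel_measurable_indicator sets.Int assms ball m)+
qed

theorem theorem2p5:
  fixes \<Omega> E :: "'a::euclidean_space set" and \<gamma> s\<^sub>0 :: real
  assumes "0 < \<gamma>" "\<gamma> < 1"
    and "bounded \<Omega>" "open \<Omega>" "C1_holder_boundary \<gamma> \<Omega>"
    and "E \<in> sets lebesgue"
    and "0 < s\<^sub>0" "s\<^sub>0 < 1" "s_perimeter s\<^sub>0 E \<Omega> < \<infinity>"
    and "\<exists>a. (weighted_tail E \<longlongrightarrow> a) (at_right 0)"
  shows "E \<in> limit_family \<Omega> \<and>
    limit_mu \<Omega> E =
      (1 - alpha_tilde E) * scaled_volume (E \<inter> \<Omega>) + alpha_tilde E * scaled_volume (\<Omega> - E)"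
proof -
  let ?\<sigma> = "sphere_measure TYPE('a)"
  obtain a where a: "(weighted_tail E \<longlongrightarrow> a) (at_right 0)" using assms by blast
  have \<sigma>: "?\<sigma> > 0" by (simp add: sphere_measure_eq)
  \<comment> \<open>The Borel set \<open>F\<close> differs from \<open>E\<close> by a null set, so
    it has the same perimeters and the same weighted tails, and its parts inside and outside have
    the same volumes in \<Omega>.\<close>
  obtain F N where F: "F \<in> sets borel" "negligible N" "F \<union> N = E"
    using sets_lebesgue_almost_borel[OF assms(6)] by metis
  have "AE x in lebesgue. x \<notin> N" using F(2) by (auto simp: negligible_iff_null_sets intro: AE_not_in)
  then have EF: "AE x in lebesgue. x \<in> E \<longleftrightarrow> x \<in> F" by eventually_elim (use F(3) in auto)
  have FL: "F \<in> sets lebesgue" using F(1) by simp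
  have perEF: "s_perimeter s E \<Omega> = s_perimeter s F \<Omega>" for s by (rule s_perimeter_cong_AE[OF EF])
  have "weighted_tail E = weighted_tail F"
    by (rule ext) (rule weighted_tail_cong_AE[OF EF assms(6) FL])
  then have aF: "(weighted_tail F \<longlongrightarrow> a) (at_right 0)" using a by simp
  obtain M0 where "\<Omega> \<subseteq> ball 0 M0" using \<open>bounded \<Omega>\<close> bounded_subset_ballD by blast
  then have sub: "\<Omega> \<subseteq> ball 0 (max 1 M0)" by force
  interpret perimeter_bounds F \<Omega> "max 1 M0" s\<^sub>0
    using F(1) sub assms perEF by unfold_locales auto
  define Q where "Q = vol_in * (?\<sigma> - a) + vol_out * a"
  have lim: "((\<lambda>s. ennreal s * s_perimeter s E \<Omega>) \<longlongrightarrow> ennreal Q) (at_right 0)"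
    unfolding perEF Q_def by (rule s_perimeter_tendsto[OF aF])
  \<comment> \<open>The bounds on \<open>a\<close> that follow give \<open>0 \<le> Q\<close>;
    otherwise \<open>ennreal Q\<close> would be cut off at zero and \<open>limit_mu\<close> would
    not return \<open>Q\<close>.\<close>
  have ev: "\<forall>\<^sub>F s in at_right 0. (0::real) < s" by (simp add: eventually_at_right_less)
  have "0 \<le> a"
    by (rule tendsto_lowerbound[OF aF]) (use ev in eventually_elim, auto simp: tail_eq_weighted_tail(2)[OF F(1)])
  have "a \<le> ?\<sigma>"
  proof (rule tendsto_upperbound[OF aF])
    show "\<forall>\<^sub>F s in at_right 0. weighted_tail F s \<le> ?\<sigma>"
      using ev
    proof eventually_elim
      case (elim s)
      have "0 \<le> weighted_tail (- F) s" using elim by (intro tail_eq_weighted_tail(2)) measurable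
      then show ?case using weighted_tail_Compl[OF F(1) elim] by simp
    qed
  qed simp
  with \<open>0 \<le> a\<close> have Q0: "0 \<le> Q" using vol_nonneg by (simp add: Q_def)
  have "E \<in> limit_family \<Omega>"
    unfolding limit_family_def using assms(6) lim by (auto intro!: exI[of _ "ennreal Q"])
  moreover have "limit_mu \<Omega> E = Q"
    using tendsto_Lim[OF _ lim] Q0 by (simp add: limit_mu_def)
  moreover have "alpha_tilde E = a / ?\<sigma>"
    using tendsto_Lim[OF _ a] by (simp add: alpha_tilde_def alpha_def)
  moreover have "scaled_volume (E \<inter> \<Omega>) = ?\<sigma> * vol_in"
  proof -
    have "measure lebesgue (E \<inter> \<Omega>) = measure lebesgue (F \<inter> \<Omega>)"
      using EF assms(4,6) FL by (intro measure_eq_AE) (auto elim: eventually_mono)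
    then show ?thesis by (simp add: scaled_volume_def vol_in_def measure_completion)
  qed
  moreover have "scaled_volume (\<Omega> - E) = ?\<sigma> * vol_out"
  proof -
    have "measure lebesgue (\<Omega> - E) = measure lebesgue (- F \<inter> \<Omega>)"
      using EF assms(4,6) FL by (intro measure_eq_AE) (auto elim: eventually_mono)
    then show ?thesis by (simp add: scaled_volume_def vol_out_def measure_completion)
  qed
  moreover have "(1 - a / ?\<sigma>) * (?\<sigma> * vol_in) + a / ?\<sigma> * (?\<sigma> * vol_out) = Q"
    using \<sigma> by (simp add: Q_def field_simps)
  ultimately show ?thesis by simp
qed

end
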